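(* For every $n\ge1$, $$\sum_{\sigma\in S_n} q^{\,\mathrm{run}(\sigma)-1+2\,\mathrm{lsg}^*(\sigma)+\mathrm{rsg}^*(\sigma)+\nu(\sigma)}=[n]_q!.$$
   Context: $[n]_q=\frac{1-q^n}{1-q}$, $[n]_q!=[n]_q\cdots[1]_q$. A permutation $\sigma\in S_n$ is written as the word $\sigma(1)\cdots\sigma(n)$; its runs are the maximal contiguous increasing segments, $\mathrm{run}(\sigma)$ is their number. A run of length $\ge2$ is proper, of length 1 is a singleton run. Classes of elements: openers (first elements of proper runs), closers (last elements of proper runs), singletons (elements forming singleton runs), continuators (all other elements). Let $R_1$ denote the run containing the value $1$. For $i\in\{1,\dots,n\}$: if $i$ is a closer or singleton, $\mathrm{lsg}^*(i)$ is the number of runs other than $R_1$ lying strictly to the left of $i$ (not containing $i$) that contain both an element smaller and an element greater than $i$; if $i$ is an opener or continuator, $\mathrm{lsg}^*(i)$ is the number of runs lying strictly to the left of $i$ that either equal $R_1$ or contain both an element smaller and an element greater than $i$. $\mathrm{rsg}^*(i)$ is defined analogously with runs strictly to the right of $i$. Then $\mathrm{lsg}^*(\sigma)=\sum_i\mathrm{lsg}^*(i)$, $\mathrm{rsg}^*(\sigma)=\sum_i\mathrm{rsg}^*(i)$. The statistic $\nu(\sigma)$ (denoted $n(\sigma)$ in the paper): let $d$ be the largest element of $R_1$. Consider the subword $w$ of $\sigma$ consisting of the entries to the right of $d$. If no left-to-right minimum of $w$ forms a singleton run of $\sigma$, put $\nu(\sigma)=0$. Otherwise let $c$ be the rightmost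 left-to-right minimum of $w$ that forms a singleton run of $\sigma$, let $\mathrm{nleft}(\sigma)=\#\{i: i<\sigma^{-1}(1),\ c<\sigma(i)<d\}$, and put $\nu(\sigma)=2(d-c)-\mathrm{nleft}(\sigma)$. (Example: for $\sigma=7\,12\,|\,1\,6\,9\,|\,3\,|\,2\,10\,11\,|\,5\,|\,4\,8$ one has $d=9$, $c=3$, $\mathrm{nleft}=1$, $\nu(\sigma)=11$, $\mathrm{lsg}^*(\sigma)=10$, $\mathrm{rsg}^*(\sigma)=8$.) *)

theory Defs
  imports "HOL-Combinatorics.Multiset_Permutations"
begin

(* A permutation sigma in S_n is the word sigma(1)...sigma(n), represented as a list
   (an element of permutations_of_set {1..n}); positions are 0-based list indices. *)

definition qint :: "nat \<Rightarrow> 'a::comm_ring_1 \<Rightarrow> 'a" where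
  "qint n q = (\<Sum>k<n. q ^ k)"

definition qfact :: "nat \<Rightarrow> 'a::comm_ring_1 \<Rightarrow> 'a" where
  "qfact n q = (\<Prod>k=1..n. qint k q)"

(* number of descents strictly before position i: runs are separated exactly by descents *)
definition desc_before :: "nat list \<Rightarrow> nat \<Rightarrow> nat" where
  "desc_before s i = card {j. j + 1 \<le> i \<and> s ! j > s ! (j + 1)}"

(* the run (maximal contiguous increasing segment) containing position p, as a set of positions *)
definition run_of :: "nat list \<Rightarrow> nat \<Rightarrow> nat set" where
  "run_of s p = {j. j < length s \<and> desc_before s j = desc_before s p}"

definition runs :: "nat list \<Rightarrow> nat set set" where
  "runs s = run_of s ` {..<length s}"

definition nruns :: "nat list \<Rightarrow> nat" where
  "nruns s = card (runs s)"

definition is_opener :: "nat list \<Rightarrow> nat \<Rightarrow> bool" where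
  "is_opener s p = (card (run_of s p) \<ge> 2 \<and> p = Min (run_of s p))"

definition is_closer :: "nat list \<Rightarrow> nat \<Rightarrow> bool" where
  "is_closer s p = (card (run_of s p) \<ge> 2 \<and> p = Max (run_of s p))"

definition is_singleton :: "nat list \<Rightarrow> nat \<Rightarrow> bool" where
  "is_singleton s p = (card (run_of s p) = 1)"

definition pos :: "nat list \<Rightarrow> nat \<Rightarrow> nat" where
  "pos s v = (THE p. p < length s \<and> s ! p = v)"

definition R1 :: "nat list \<Rightarrow> nat set" where
  "R1 s = run_of s (pos s 1)"

definition straddles :: "nat list \<Rightarrow> nat set \<Rightarrow> nat \<Rightarrow> bool" where
  "straddles s R v = ((\<exists>a\<in>R. s ! a < v) \<and> (\<exists>b\<in>R. s ! b > v))"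

definition lsg_star_at :: "nat list \<Rightarrow> nat \<Rightarrow> nat" where
  "lsg_star_at s p =
    (if is_closer s p \<or> is_singleton s p then
       card {R \<in> runs s. R \<noteq> run_of s p \<and> (\<forall>a\<in>R. a < p) \<and> R \<noteq> R1 s \<and> straddles s R (s ! p)}
     else
       card {R \<in> runs s. R \<noteq> run_of s p \<and> (\<forall>a\<in>R. a < p) \<and> (R = R1 s \<or> straddles s R (s ! p))})"

definition rsg_star_at :: "nat list \<Rightarrow> nat \<Rightarrow> nat" where
  "rsg_star_at s p =
    (if is_closer s p \<or> is_singleton s p then
       card {R \<in> runs s. R \<noteq> run_of s p \<and> (\<forall>a\<in>R. a > p) \<and> R \<noteq> R1 s \<and> straddles s R (s ! p)}
     else
       card {R \<in> runs s. R \<noteq> run_of s p \<and> (\<forall>a\<in>R. a > p) \<and> (R = R1 s \<or> straddles s R (s ! p))})"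

definition lsg_star :: "nat list \<Rightarrow> nat" where
  "lsg_star s = (\<Sum>p<length s. lsg_star_at s p)"

definition rsg_star :: "nat list \<Rightarrow> nat" where
  "rsg_star s = (\<Sum>p<length s. rsg_star_at s p)"

definition dval :: "nat list \<Rightarrow> nat" where
  "dval s = Max ((\<lambda>a. s ! a) ` R1 s)"

definition lrmin_w :: "nat list \<Rightarrow> nat \<Rightarrow> bool" where
  "lrmin_w s p = (pos s (dval s) < p \<and> p < length s \<and>
                  (\<forall>p'. pos s (dval s) < p' \<and> p' < p \<longrightarrow> s ! p < s ! p'))"

definition nu :: "nat list \<Rightarrow> nat" where
  "nu s = (let C = {p. lrmin_w s p \<and> is_singleton s p} in
           if C = {} then 0
           else (let d = dval s; c = s ! (Max C);
                     nleft = card {i. i < pos s 1 \<and> c < s ! i \<and> s ! i < d}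
                 in 2 * (d - c) - nleft))"

end

theory Submission
  imports Defs
begin

text \<open>
  Build a permutation by inserting the values 1, 2, ... in increasing order, remembering only where
  larger values are still to come. Such a partial permutation is a \<^emph>\<open>gapped word\<close>: maximal blocks of
  missing larger values are represented by a gap, and a virtual gap precedes the word. The next
  value is put into a gap, and a gap may or may not survive on either side of it; the four cases
  make the value a closer, a singleton, a continuator or an opener. The contribution of a value to
  the statistic is fixed at the moment of its insertion. It depends only on the index of the gap and
  on a small state: the number a + 1 of gaps to the left of 1, the number b of gaps to the right of
  the run of 1, whether that run is closed, and, while it is open, whether it is marked, that is,
  whether some singleton has been put into the gap ending that run. The term
  2(d - c) - nleft is exactly an extra weight of 1 or 2, according to the side of 1, for each value
  inserted after the first such singleton c up to the largest element d of the run of 1.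

  Writing C, U, M for the weighted numbers of completions by m values of a closed, open unmarked and
  open marked state, induction on m gives M(a, b) = q^2 C(a, b + 1), and then that
  C(a, b) + U(a, b) depends only on k = a + b and is the sum over the Motzkin paths from height k
  to 0 whose weights are those of the J-fraction of the sequence [m + 1]!. After the value 1 the
  state is C(0, 0) or U(0, 0), so the total is [n]!.
\<close>

section \<open>Weighted Laguerre histories\<close>

lemma qint_0 [simp]: "qint 0 q = 0"
  by (simp add: qint_def)

lemma qint_Suc: "qint (Suc n) q = 1 + q * qint n q"
  by (simp add: qint_def sum.lessThan_Suc_shift sum_distrib_left del: sum.lessThan_Suc)

lemma qint_add: "qint (m + n) q = qint m q + q ^ m * qint n q"
  by (induction m) (simp_all add: qint_Suc algebra_simps)

lemma qfact_Suc: "qfact (Suc n) q = qfact n q * qint (Suc n) q"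
  by (simp add: qfact_def)

text \<open>Gaussian binomials by the q-Pascal rule, since a quotient of q-factorials makes no sense
  in an arbitrary commutative ring.\<close>

fun qbinom :: "nat \<Rightarrow> nat \<Rightarrow> 'a::comm_ring_1 \<Rightarrow> 'a" where
  "qbinom n 0 q = 1"
| "qbinom 0 (Suc k) q = 0"
| "qbinom (Suc n) (Suc k) q = qbinom n k q + q ^ Suc k * qbinom n (Suc k) q"

text \<open>The ratio of neighbouring Gaussian binomials, cleared of denominators. For k <= n the
  difference \<open>qint n q - qint k q\<close> is q^k [n-k]; in this form no power of q has to be
  cancelled.\<close>

lemma qbinom_Suc_right:
  "q ^ k * qint (Suc k) q * qbinom n (Suc k) q = (qint n q - qint k q) * qbinom n k q"
proof (induction n arbitrary: k)
  case 0
  then show ?case by (cases k) simp_all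
next
  case (Suc n)
  show ?case
  proof (cases k)
    case 0
    then show ?thesis using Suc[of 0] by (simp add: qint_Suc algebra_simps)
  next
    case (Suc k')
    have 1: "q ^ k' * qint k q * qbinom n k q = (qint n q - qint k' q) * qbinom n k' q"
      using Suc.IH[of k'] Suc by simp
    have 2: "q ^ k * qint (Suc k) q * qbinom n (Suc k) q = (qint n q - qint k q) * qbinom n k q"
      using Suc.IH[of k] .
    have "q ^ k * qint (Suc k) q * qbinom (Suc n) (Suc k) q =
        q ^ k * qint (Suc k) q * qbinom n k q
        + q ^ Suc k * (q ^ k * qint (Suc k) q * qbinom n (Suc k) q)"
      by (simp add: algebra_simps)
    also have "\<dots> = q ^ k * (1 + q * qint n q) * qbinom n k q"
      unfolding 2 by (simp add: qint_Suc algebra_simps)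
    also have "\<dots> = q * (q ^ k' * qint k q * qbinom n k q)
        + q ^ k * (qint (Suc n) q - qint k q) * qbinom n k q"
      using Suc by (simp add: qint_Suc algebra_simps)
    also have "\<dots> = (qint (Suc n) q - qint k q) * qbinom (Suc n) k q"
      unfolding 1 using Suc by (simp add: qint_Suc algebra_simps)
    finally show ?thesis .
  qed
qed

text \<open>Motzkin paths with m steps from height k to 0, split by their first step: down, level
  (two colours), up. At k = 0 the factor \<open>qint 0 q\<close> removes the down step.\<close>

primrec laguerre_sum :: "'a::comm_ring_1 \<Rightarrow> nat \<Rightarrow> nat \<Rightarrow> 'a" where
  "laguerre_sum q 0 k = (if k = 0 then 1 else 0)"
| "laguerre_sum q (Suc m) k =
     q ^ (k - 1) * qint k q * laguerre_sum q m (k - 1)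
     + (1 + q) * q ^ k * qint (Suc k) q * laguerre_sum q m k
     + q ^ (k + 2) * qint (k + 2) q * laguerre_sum q m (Suc k)"

text \<open>For the guessed closed form, \<open>qbinom_Suc_right\<close> turns the up term and one
  colour of the level term into multiples of neighbouring binomials. The terms with [k] and [k+1]
  cancel, and [m+1] times the q-Pascal sum remains.\<close>

lemma laguerre_sum_closed:
  "laguerre_sum q m k = q ^ (k choose 2) * qfact m q * qbinom (Suc m) (Suc k) q"
proof (induction m arbitrary: k)
  case 0
  then show ?case by (cases k) (simp_all add: qfact_def numeral_2_eq_2)
next
  case (Suc m)
  let ?M = "Suc m" and ?B = "\<lambda>k. qbinom (Suc m) k q"
  have c: "q ^ (Suc k choose 2) = q ^ k * q ^ (k choose 2)" for k
    by (simp add: numeral_2_eq_2 power_add)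
  have t1: "q ^ (k - 1) * qint k q * laguerre_sum q m (k - 1)
      = q ^ (k choose 2) * qfact m q * (qint k q * ?B k)"
    by (cases k) (simp_all add: Suc c algebra_simps del: qbinom.simps)
  have b1: "q ^ k * qint (Suc k) q * ?B (Suc k) = (qint ?M q - qint k q) * ?B k"
    by (rule qbinom_Suc_right)
  have b2: "q ^ Suc k * qint (Suc (Suc k)) q * ?B (Suc (Suc k))
      = (qint ?M q - qint (Suc k) q) * ?B (Suc k)"
    by (rule qbinom_Suc_right)
  have t3: "q ^ (k + 2) * qint (k + 2) q * laguerre_sum q m (Suc k)
      = q ^ (k choose 2) * qfact m q * (q ^ Suc k * ((qint ?M q - qint (Suc k) q) * ?B (Suc k)))"
    unfolding b2[symmetric] by (simp add: Suc c algebra_simps del: qbinom.simps)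
  have t2: "(1 + q) * q ^ k * qint (Suc k) q * laguerre_sum q m k
      = q ^ (k choose 2) * qfact m q * (q ^ k * qint (Suc k) q * ?B (Suc k)
        + q ^ Suc k * qint (Suc k) q * ?B (Suc k))"
    by (simp add: Suc algebra_simps del: qbinom.simps)
  have "laguerre_sum q (Suc m) k = q ^ (k choose 2) * qfact m q *
      (qint k q * ?B k + (q ^ k * qint (Suc k) q * ?B (Suc k)
        + q ^ Suc k * qint (Suc k) q * ?B (Suc k))
        + q ^ Suc k * ((qint ?M q - qint (Suc k) q) * ?B (Suc k)))"
    unfolding laguerre_sum.simps t1 t2 t3 by (simp only: distrib_left)
  also have "\<dots> = q ^ (k choose 2) * qfact m q * (qint ?M q * (?B k + q ^ Suc k * ?B (Suc k)))"
    unfolding b1 by (simp add: algebra_simps del: qbinom.simps)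
  also have "\<dots> = q ^ (k choose 2) * qfact (Suc m) q * qbinom (Suc (Suc m)) (Suc k) q"
    by (simp add: qfact_Suc algebra_simps del: qbinom.simps(3)) (simp add: algebra_simps)
  finally show ?case .
qed

lemma laguerre_sum_0: "laguerre_sum q m 0 = qfact (Suc m) q"
proof -
  have "qbinom (Suc m) 1 q = qint (Suc m) q"
    using qbinom_Suc_right[of q 0 "Suc m"] by (simp add: qint_Suc)
  then show ?thesis
    by (simp add: laguerre_sum_closed qfact_Suc numeral_2_eq_2)
qed

text \<open>
  One insertion into a gap other than the one ending the run of 1: \<open>u\<close> and \<open>v\<close> are extra weights for
  gaps to the left and to the right of that run. The truncated subtractions in the exponents and
  arguments occur only next to a factor \<open>qint 0\<close>.
\<close>
definition fill_step :: "'a::comm_ring_1 \<Rightarrow> 'a \<Rightarrow> 'a \<Rightarrow> (nat \<Rightarrow> nat \<Rightarrow> 'a) \<Rightarrow> nat \<Rightarrow> nat \<Rightarrow> 'a" where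
  "fill_step q u v F a b =
     u * (q ^ (a + b - 1) * qint a q * F (a - 1) b
        + q ^ (a + b) * qint a q * F a b
        + q ^ (a + b + 1) * qint (Suc a) q * F a b
        + q ^ (a + b + 2) * qint (Suc a) q * F (Suc a) b)
   + v * (q ^ (2 * a + b - 1) * qint b q * F a (b - 1)
        + (q ^ (2 * a + b + 1) + q ^ (2 * a + b + 2)) * qint b q * F a b
        + q ^ (2 * a + b + 4) * qint b q * F a (Suc b))"

text \<open>With no value left to insert, only the virtual gap may remain, which a does not count.
  An open run of 1 still awaits a value, so the next two sums start from 0.\<close>

primrec closed_sum :: "'a::comm_ring_1 \<Rightarrow> nat \<Rightarrow> nat \<Rightarrow> nat \<Rightarrow> 'a" where
  "closed_sum q 0 = (\<lambda>a b. if a = 0 \<and> b = 0 then 1 else 0)"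
| "closed_sum q (Suc m) = fill_step q 1 1 (closed_sum q m)"

text \<open>The bracket collects the insertions into the gap ending the run of 1, in the order
  closer, singleton, continuator, opener. The mark costs 1 for a value to the left of 1 and 2
  otherwise, whence q and q^2.\<close>

primrec marked_sum :: "'a::comm_ring_1 \<Rightarrow> nat \<Rightarrow> nat \<Rightarrow> nat \<Rightarrow> 'a" where
  "marked_sum q 0 = (\<lambda>a b. 0)"
| "marked_sum q (Suc m) = (\<lambda>a b. fill_step q q (q ^ 2) (marked_sum q m) a b
     + q ^ 2 * (q ^ (2 * a + b) * closed_sum q m a b
              + q ^ (2 * a + b + 1) * marked_sum q m a b
              + q ^ (2 * a + b) * marked_sum q m a b
              + q ^ (2 * a + b + 3) * marked_sum q m a (Suc b)))"

text \<open>\<open>marked_sum\<close> enters through the singleton case, which creates the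
  mark.\<close>

primrec open_sum :: "'a::comm_ring_1 \<Rightarrow> nat \<Rightarrow> nat \<Rightarrow> nat \<Rightarrow> 'a" where
  "open_sum q 0 = (\<lambda>a b. 0)"
| "open_sum q (Suc m) = (\<lambda>a b. fill_step q 1 1 (open_sum q m) a b
     + (q ^ (2 * a + b) * closed_sum q m a b
      + q ^ (2 * a + b + 1) * marked_sum q m a b
      + q ^ (2 * a + b) * open_sum q m a b
      + q ^ (2 * a + b + 3) * open_sum q m a (Suc b)))"

text \<open>A marked state counts like a closed one in which the gap ending the run of 1 is an
  ordinary gap on the right: in [b+1] = 1 + q[b] the summand 1 stands for that gap and q[b] for the
  b others, and the extra weights q and q^2 supply the missing powers.\<close>

lemma marked_sum_eq: "marked_sum q m a b = q ^ 2 * closed_sum q m a (Suc b)"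
proof (induction m arbitrary: a b)
  case (Suc m)
  define C where "C = closed_sum q m"
  have M: "marked_sum q m = (\<lambda>a b. q ^ 2 * C a (Suc b))"
    using Suc by (auto simp: C_def fun_eq_iff)
  \<comment> \<open>This fact and the next two remove the truncated subtractions; at 0 both sides
    vanish with the factor \<open>qint\<close>.\<close>
  have b: "qint b q * C a (Suc (b - 1)) = qint b q * C a b"
    by (cases b) simp_all
  have a: "q ^ (a + b - 1) * qint a q * q = q ^ (a + b) * qint a q"
    by (cases a) simp_all
  have b': "q ^ (2 * a + b - 1) * qint b q * q = q ^ (2 * a + b) * qint b q"
    by (cases b) simp_all
  have 1: "q * (q ^ (a + b - 1) * qint a q * (q\<^sup>2 * X)) = q ^ 2 * (q ^ (a + b) * qint a q * X)" for X
    using arg_cong[OF a, of "\<lambda>z. z * q\<^sup>2 * X"] by (simp add: algebra_simps)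
  have 2: "q\<^sup>2 * (q ^ (2 * a + b - 1) * qint b q * (q\<^sup>2 * C a (Suc (b - 1))))
      = q ^ 2 * (q ^ (2 * a + b + 1) * qint b q * C a b)"
    using arg_cong[OF b', of "\<lambda>z. z * q\<^sup>2 * q * C a b"]
      arg_cong[OF b, of "\<lambda>z. z * q\<^sup>2 * q\<^sup>2 * q ^ (2 * a + b - 1)"]
    by (simp add: algebra_simps power2_eq_square)
  show ?case
    unfolding marked_sum.simps closed_sum.simps M C_def[symmetric] fill_step_def
    by (simp only: distrib_left distrib_right 1 2)
      (simp add: qint_Suc algebra_simps power2_eq_square power_add numeral_eq_Suc)
qed simp

text \<open>By \<open>marked_sum_eq\<close> the singleton term of the bracket becomes q^(2a+b+3)
  C(a, b+1) and pairs with the opener term; the closer term pairs with the continuator term. So C +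
  U satisfies a recursion of its own, and [a] + q^a [b] = [a+b] makes it depend on a + b
  only.\<close>

lemma closed_plus_open_sum: "closed_sum q m a b + open_sum q m a b = laguerre_sum q m (a + b)"
proof (induction m arbitrary: a b)
  case (Suc m)
  define C U where "C = closed_sum q m" and "U = open_sum q m"
  define S where "S = laguerre_sum q m"
  have CU: "U a b = S (a + b) - C a b" for a b
    using Suc[of a b] by (simp add: C_def U_def S_def algebra_simps)
  \<comment> \<open>Two expansions of [a+1], compared; this expresses the isolated power q^a by [a],
    so that ring arithmetic can match the coefficients.\<close>
  have qa: "q ^ a = 1 + q * qint a q - qint a q"
    using qint_add[of a 1 q] by (simp add: qint_Suc)
  have e1: "q ^ (a + b - 1) * qint a q * S (a - 1 + b) + q ^ (2 * a + b - 1) * qint b q * S (a + (b - 1))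
      = q ^ (a + b - 1) * qint (a + b) q * S (a + b - 1)"
  proof -
    have "q ^ (2 * a + b - 1) * qint b q = q ^ (a + b - 1) * (q ^ a * qint b q)"
      by (cases b) (simp_all add: power_add mult_2 mult.assoc)
    moreover have "qint a q * S (a - 1 + b) = qint a q * S (a + b - 1)"
      and "qint b q * S (a + (b - 1)) = qint b q * S (a + b - 1)"
      by (cases a; cases b; simp)+
    ultimately show ?thesis
      by (simp add: qint_add distrib_left distrib_right mult.assoc)
  qed
  have "closed_sum q (Suc m) a b + open_sum q (Suc m) a b =
      (q ^ (a + b - 1) * qint a q * S (a - 1 + b) + q ^ (2 * a + b - 1) * qint b q * S (a + (b - 1)))
      + (q ^ (a + b) * qint a q + q ^ (a + b + 1) * qint (Suc a) q
         + (q ^ (2 * a + b + 1) + q ^ (2 * a + b + 2)) * qint b q + q ^ (2 * a + b)) * S (a + b)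
      + (q ^ (a + b + 2) * qint (Suc a) q + q ^ (2 * a + b + 4) * qint b q + q ^ (2 * a + b + 3))
        * S (Suc (a + b))"
    unfolding open_sum.simps closed_sum.simps C_def[symmetric] U_def[symmetric] fill_step_def
      marked_sum_eq
    by (simp add: CU algebra_simps power2_eq_square power_add numeral_eq_Suc)
  also have "(q ^ (a + b) * qint a q + q ^ (a + b + 1) * qint (Suc a) q
         + (q ^ (2 * a + b + 1) + q ^ (2 * a + b + 2)) * qint b q + q ^ (2 * a + b))
      = (1 + q) * q ^ (a + b) * qint (Suc (a + b)) q"
    by (simp add: qint_Suc qint_add power_add mult_2 numeral_eq_Suc) (simp add: qa algebra_simps)
  also have "(q ^ (a + b + 2) * qint (Suc a) q + q ^ (2 * a + b + 4) * qint b q + q ^ (2 * a + b + 3))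
      = q ^ (a + b + 2) * qint (a + b + 2) q"
    by (simp add: qint_Suc qint_add power_add mult_2 numeral_eq_Suc) (simp add: qa algebra_simps)
  also note e1
  finally show ?case
    by (simp only: laguerre_sum.simps S_def)
qed simp

section \<open>Contributions of the letters of a word\<close>

definition before :: "'b \<Rightarrow> 'b list \<Rightarrow> 'b list" where
  "before v w = takeWhile (\<lambda>u. u \<noteq> v) w"

definition after :: "'b \<Rightarrow> 'b list \<Rightarrow> 'b list" where
  "after v w = tl (dropWhile (\<lambda>u. u \<noteq> v) w)"

lemma before_append_Cons [simp]: "v \<notin> set P \<Longrightarrow> before v (P @ v # Q) = P"
  by (induction P) (auto simp: before_def)

lemma after_append_Cons [simp]: "v \<notin> set P \<Longrightarrow> after v (P @ v # Q) = Q"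
  by (induction P) (auto simp: after_def)

text \<open>
  Ascents jumping over \<open>v\<close>; in a permutation they correspond to the runs that contain both smaller
  and greater elements but not \<open>v\<close> itself.
\<close>
fun cross :: "nat \<Rightarrow> nat list \<Rightarrow> nat" where
  "cross v (a # b # xs) = of_bool (a < v \<and> v < b) + cross v (b # xs)"
| "cross v _ = 0"

fun run_end :: "nat \<Rightarrow> nat list \<Rightarrow> nat" where
  "run_end a [] = a"
| "run_end a (b # Q) = (if b < a then a else run_end b Q)"

text \<open>All letters in front of c exceed c, and \<open>Q\<close> is meant to follow a descent,
  so c starts a run; the letter behind it decides whether this run is a singleton.\<close>

fun lrmin_singleton :: "nat \<Rightarrow> nat list \<Rightarrow> bool" where
  "lrmin_singleton c [] = False"
| "lrmin_singleton c (b # Q) =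
     (if c < b then lrmin_singleton c Q else b = c \<and> (Q = [] \<or> hd Q < c))"

text \<open>The same for the part of \<open>Q\<close> behind the increasing run that continues \<open>a\<close>.\<close>
fun lrmin_singleton_past :: "nat \<Rightarrow> nat \<Rightarrow> nat list \<Rightarrow> bool" where
  "lrmin_singleton_past c a [] = False"
| "lrmin_singleton_past c a (b # Q) =
     (if b < a then False else if c < b then lrmin_singleton c Q else lrmin_singleton_past c b Q)"

definition end1 :: "nat list \<Rightarrow> nat" where
  "end1 w = run_end 1 (after 1 w)"

definition special :: "nat \<Rightarrow> nat list \<Rightarrow> bool" where
  "special c w = lrmin_singleton_past c 1 (after 1 w)"

definition marked :: "nat \<Rightarrow> nat list \<Rightarrow> bool" where
  "marked v w = (\<exists>c\<in>{1..<v}. special c w)"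

definition rises :: "nat \<Rightarrow> nat list \<Rightarrow> bool" where
  "rises v w = (after v w \<noteq> [] \<and> v < hd (after v w))"

text \<open>
  For a closer or singleton the run of 1 is excluded, for an opener or continuator it always counts,
  while \<^const>\<open>cross\<close> counts it precisely when \<open>v\<close> lies below its last element.
\<close>
definition side_count :: "nat \<Rightarrow> nat list \<Rightarrow> nat list \<Rightarrow> nat" where
  "side_count v w X =
     (if 1 \<in> set X then
        if rises v w then cross v X + of_bool (\<not> v < end1 w)
        else cross v X - of_bool (v < end1 w)
      else cross v X)"

text \<open>The condition v <= d is put as \<open>v - 1 < end1 w\<close> because a strict comparison
  with the preceding value is already decided before v is inserted.\<close>

definition mark_weight :: "nat \<Rightarrow> nat list \<Rightarrow> nat" where
  "mark_weight v w =
     (if v - 1 < end1 w \<and> marked v w then if 1 \<in> set (after v w) then 1 else 2 else 0)"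

text \<open>The first summand tests whether v starts a run. The words in question are headed by a
  letter above all values, so the first entry of the permutation passes the test.\<close>

definition contrib :: "nat \<Rightarrow> nat list \<Rightarrow> nat" where
  "contrib v w = of_bool (v < last (before v w)) + 2 * side_count v w (before v w)
     + side_count v w (after v w) + mark_weight v w"

lemma cross_Cons_ge: "v \<le> a \<Longrightarrow> cross v (a # xs) = cross v xs"
  by (cases xs) auto

lemma cross_append_greater: "\<forall>y\<in>set F. v < y \<Longrightarrow> cross v (F @ B) = cross v B"
  by (induction F) (auto simp: cross_Cons_ge)

lemma run_end_ge: "a \<le> run_end a Q"
  by (induction a Q rule: run_end.induct) auto

lemma run_end_mem: "run_end a Q \<in> insert a (set Q)"
  by (induction a Q rule: run_end.induct) auto

lemma run_end_max: "\<forall>y\<in>set Q. y \<le> a \<Longrightarrow> run_end a Q = a"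
  using run_end_ge[of a Q] run_end_mem[of a Q] by fastforce

lemma run_end_append_sorted: "sorted (a # R) \<Longrightarrow> run_end a (R @ Q) = run_end (last (a # R)) Q"
  by (induction R arbitrary: a) auto

lemma lrmin_singleton_mem: "lrmin_singleton c Q \<Longrightarrow> c \<in> set Q"
  by (induction Q) (auto split: if_splits)

lemma lrmin_singleton_past_mem: "lrmin_singleton_past c a Q \<Longrightarrow> c \<in> set Q"
  by (induction c a Q rule: lrmin_singleton_past.induct)
    (auto split: if_splits dest: lrmin_singleton_mem)

lemma lrmin_singleton_past_append_sorted:
  "sorted (a # R) \<Longrightarrow> \<forall>y\<in>set R. y \<le> c \<Longrightarrow>
     lrmin_singleton_past c a (R @ Q) = lrmin_singleton_past c (last (a # R)) Q"
  by (induction R arbitrary: a) auto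

lemma lrmin_singleton_append_greater:
  "\<forall>y\<in>set F. c < y \<Longrightarrow> lrmin_singleton c (F @ B) = lrmin_singleton c B"
  by (induction F) auto

text \<open>A value does not notice how a gap is refilled with larger letters.\<close>

context
  fixes v :: nat and F G :: "nat list"
  assumes FG: "F \<noteq> []" "G \<noteq> []" "\<forall>y\<in>set F. v < y" "\<forall>y\<in>set G. v < y"
begin

lemma cross_refill: "cross v (A @ F @ B) = cross v (A @ G @ B)"
proof (induction A)
  case Nil
  then show ?case using FG by (simp add: cross_append_greater)
next
  case (Cons a A)
  then show ?case using FG by (cases A; cases F; cases G) auto
qed

text \<open>The run end itself may change, but a run that reaches the block ends above v whatever
  the block is.\<close>

lemma run_end_refill: "v < run_end a (A @ F @ B) \<longleftrightarrow> v < run_end a (A @ G @ B)"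
proof (induction A arbitrary: a)
  case Nil
  have "v < run_end a (f # Q)" if "v < f" for f Q
    using that run_end_ge[of f Q] by auto
  then show ?case using FG by (cases F; cases G) auto
qed auto

lemma lrmin_singleton_refill:
  assumes "c \<le> v"
  shows "lrmin_singleton c (A @ F @ B) \<longleftrightarrow> lrmin_singleton c (A @ G @ B)"
proof (induction A)
  case Nil
  have "\<forall>y\<in>set F. c < y" "\<forall>y\<in>set G. c < y"
    using FG assms by fastforce+
  then show ?case by (simp add: lrmin_singleton_append_greater)
next
  case (Cons a A)
  then show ?case using FG assms by (cases A; cases F; cases G) auto
qed

lemma lrmin_singleton_past_refill:
  assumes "a \<le> c" "c \<le> v"
  shows "lrmin_singleton_past c a (A @ F @ B) \<longleftrightarrow> lrmin_singleton_past c a (A @ G @ B)"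
  using assms(1)
proof (induction A arbitrary: a)
  case Nil
  obtain f F' g G' where "F = f # F'" "G = g # G'"
    using FG by (meson neq_Nil_conv)
  moreover have "lrmin_singleton c (F' @ B) = lrmin_singleton c B"
      "lrmin_singleton c (G' @ B) = lrmin_singleton c B"
    using calculation FG assms(2) by (auto intro!: lrmin_singleton_append_greater)
  ultimately show ?case using FG assms Nil by auto
next
  case (Cons b A)
  then show ?case using lrmin_singleton_refill[OF assms(2)] by auto
qed

text \<open>The letters of the block exceed v and hence u, so the first u lies either in
  \<open>A\<close> or behind the block.\<close>

lemma after_refill_cases:
  assumes "u \<in> set (A @ B)" "u \<le> v"
  obtains "after u (A @ F @ B) = after u (A @ G @ B)"
      "\<exists>B1. before u (A @ F @ B) = A @ F @ B1 \<and> before u (A @ G @ B) = A @ G @ B1"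
  | A2 where "before u (A @ F @ B) = before u (A @ G @ B)"
      "after u (A @ F @ B) = A2 @ F @ B" "after u (A @ G @ B) = A2 @ G @ B"
proof (cases "u \<in> set A")
  case True
  then obtain A1 A2 where "A = A1 @ u # A2" "u \<notin> set A1"
    by (meson split_list_first)
  then show ?thesis using that(2)[of A2] by simp
next
  case False
  then obtain B1 B2 where B: "B = B1 @ u # B2" "u \<notin> set B1"
    using assms by (metis UnE set_append split_list_first)
  have "u \<notin> set (A @ F @ B1)" "u \<notin> set (A @ G @ B1)"
    using False B assms FG by auto
  then have "before u ((A @ F @ B1) @ u # B2) = A @ F @ B1" "after u ((A @ F @ B1) @ u # B2) = B2"
    "before u ((A @ G @ B1) @ u # B2) = A @ G @ B1" "after u ((A @ G @ B1) @ u # B2) = B2"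
    by (blast intro: before_append_Cons after_append_Cons)+
  then show ?thesis using that(1) B by simp
qed

context
  fixes A B :: "nat list"
  assumes one: "1 \<in> set (A @ B)" "1 \<le> v"
begin

lemma end1_refill: "v < end1 (A @ F @ B) \<longleftrightarrow> v < end1 (A @ G @ B)"
  using one(1,2)
proof (cases rule: after_refill_cases)
  case 1
  then show ?thesis by (simp add: end1_def)
next
  case (2 A2)
  then show ?thesis by (simp only: end1_def run_end_refill)
qed

lemma special_refill: "1 \<le> c \<Longrightarrow> c \<le> v \<Longrightarrow> special c (A @ F @ B) \<longleftrightarrow> special c (A @ G @ B)"
  using one(1,2)
proof (cases rule: after_refill_cases)
  case 1
  then show ?thesis by (simp add: special_def)
next
  case (2 A2)
  assume "1 \<le> c" "c \<le> v"
  then show ?thesis unfolding special_def 2 by (rule lrmin_singleton_past_refill)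
qed

end

end

text \<open>Every ingredient is a comparison of letters with v or v - 1, or concerns special letters
  below v, and there one nonempty block of larger letters acts like another. For v >= 2 the value 1
  stays at or below v - 1, as the comparison with v - 1 requires.\<close>

lemma contrib_refill:
  assumes FG: "F \<noteq> []" "G \<noteq> []" "\<forall>y\<in>set F. v < y" "\<forall>y\<in>set G. v < y"
    and one: "1 \<in> set (A @ B)" "2 \<le> v" and v: "v \<in> set (A @ B)"
  shows "contrib v (A @ F @ B) = contrib v (A @ G @ B)"
proof -
  have e: "v < end1 (A @ F @ B) \<longleftrightarrow> v < end1 (A @ G @ B)"
    using end1_refill[OF FG] one by simp
  have e': "v - 1 < end1 (A @ F @ B) \<longleftrightarrow> v - 1 < end1 (A @ G @ B)"
    using FG one by (intro end1_refill) auto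
  have m: "marked v (A @ F @ B) = marked v (A @ G @ B)"
    unfolding marked_def using special_refill[OF FG] one by (intro bex_cong) auto
  have FG1: "1 \<notin> set F" "1 \<notin> set G"
    using FG one by auto
  show ?thesis
    using v order_refl
  proof (cases rule: after_refill_cases[OF FG, consumes 2])
    case 1
    then obtain B1 where B1: "before v (A @ F @ B) = A @ F @ B1" "before v (A @ G @ B) = A @ G @ B1"
      by blast
    have r: "rises v (A @ F @ B) = rises v (A @ G @ B)"
      using 1 by (simp add: rises_def)
    have l: "v < last (A @ F @ B1) \<longleftrightarrow> v < last (A @ G @ B1)"
      using FG by (cases B1) (auto simp: last_append)
    show ?thesis
      unfolding contrib_def side_count_def mark_weight_def e e' m r B1 1(1) cross_refill[OF FG] l
      using FG1 by auto
  next
    case (2 A2)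
    have r: "rises v (A @ F @ B) = rises v (A @ G @ B)"
      unfolding rises_def 2 using FG by (cases A2; cases F; cases G) auto
    show ?thesis
      unfolding contrib_def side_count_def mark_weight_def e e' m r 2 cross_refill[OF FG]
      using FG1 by auto
  qed
qed

section \<open>Gapped words\<close>

text \<open>
  A gap is the letter \<open>N\<close>, chosen larger than every value, so that the comparisons in \<^const>\<open>contrib\<close>
  give the same result before and after a gap is filled with larger values.
\<close>
definition gapped :: "nat \<Rightarrow> nat \<Rightarrow> nat list set" where
  "gapped N i = {w. w \<noteq> [] \<and> hd w = N \<and> successively (\<lambda>a b. a \<noteq> N \<or> b \<noteq> N) w
     \<and> distinct (filter (\<lambda>u. u \<noteq> N) w) \<and> set w = insert N {1..i}}"

definition gap :: "nat \<Rightarrow> bool \<Rightarrow> nat list" where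
  "gap N l = (if l then [N] else [])"

definition splits :: "'b \<Rightarrow> 'b list \<Rightarrow> ('b list \<times> 'b list) set" where
  "splits N w = {(A, B). w = A @ N # B}"

text \<open>The leading gap is the virtual one and must stay at the front of the word.\<close>

definition gap_choices :: "'b list \<Rightarrow> (bool \<times> bool) set" where
  "gap_choices A = {(l, r). A = [] \<longrightarrow> l}"

text \<open>The flags \<open>l\<close> and \<open>r\<close> tell whether larger letters will stand
  directly before and directly after x: both give an opener, only \<open>l\<close> a singleton, only
  \<open>r\<close> a continuator, neither a closer.\<close>

definition fill :: "nat \<Rightarrow> nat \<Rightarrow> nat list \<Rightarrow> nat list \<Rightarrow> bool \<Rightarrow> bool \<Rightarrow> nat list" where
  "fill N x A B l r = A @ gap N l @ x # gap N r @ B"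

lemma gap_simps [simp]: "gap N True = [N]" "gap N False = []"
  by (simp_all add: gap_def)

lemma set_gap: "set (gap N l) = (if l then {N} else {})"
  by (simp add: gap_def)

lemma count_list_gap [simp]: "count_list (gap N l) N = of_bool l"
  by (simp add: gap_def)

lemma splits_Nil [simp]: "splits N [] = {}"
  by (simp add: splits_def)

lemma splits_Cons:
  "splits N (a # w) = (if a = N then {([], w)} else {}) \<union> (\<lambda>(A, B). (a # A, B)) ` splits N w"
  by (auto simp: splits_def Cons_eq_append_conv image_iff)

lemma finite_splits [simp]: "finite (splits N w)"
  by (induction w) (auto simp: splits_Cons)

lemma splits_append:
  "splits N (X @ Y) = (\<lambda>(A, B). (A, B @ Y)) ` splits N X \<union> (\<lambda>(A, B). (X @ A, B)) ` splits N Y"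
  by (induction X) (auto simp: splits_Cons image_Un image_image case_prod_unfold)

lemma splits_not_mem: "N \<notin> set w \<Longrightarrow> splits N w = {}"
  by (auto simp: splits_def)

lemma sum_splits_append:
  "(\<Sum>(A, B)\<in>splits N (X @ Y). f A B) =
     (\<Sum>(A, B)\<in>splits N X. f A (B @ Y)) + (\<Sum>(A, B)\<in>splits N Y. f (X @ A) B)"
proof -
  have "(\<lambda>(A, B). (A, B @ Y)) ` splits N X \<inter> (\<lambda>(A, B). (X @ A, B)) ` splits N Y = {}"
    by (auto simp: splits_def)
  moreover have "inj_on (\<lambda>(A, B). (A, B @ Y)) (splits N X)" "inj_on (\<lambda>(A, B). (X @ A, B)) (splits N Y)"
    by (auto simp: inj_on_def)
  ultimately show ?thesis
    by (simp add: splits_append sum.union_disjoint sum.reindex comp_def case_prod_unfold)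
qed

text \<open>The gaps, read from the left, have 0, 1, 2, ... gaps in front of them.\<close>

lemma sum_splits_count:
  "(\<Sum>(A, B)\<in>splits N w. h (count_list A N)) = (\<Sum>j<count_list w N. h j)"
proof (induction w rule: rev_induct)
  case (snoc a w)
  have "splits N [a] = (if a = N then {([], [])} else {})"
    by (simp add: splits_Cons)
  with snoc show ?case
    by (simp add: sum_splits_append)
qed simp

lemma sum_gap_choices:
  "(\<Sum>(l, r)\<in>gap_choices A. f l r) =
     f True True + f True False + (if A = [] then 0 else f False True + f False False)"
proof -
  have "gap_choices A = (if A = [] then {(True, True), (True, False)}
      else {(True, True), (True, False), (False, True), (False, False)})"
    by (auto simp: gap_choices_def)
  then show ?thesis by (simp add: add.assoc)
qed

lemma finite_gap_choices [simp]: "finite (gap_choices A)"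
  by (rule finite_subset[of _ UNIV]) auto

text \<open>Gaps are never adjacent, so each gap except a leading one follows a smaller value and
  yields exactly one ascent over x.\<close>

lemma cross_eq_count:
  assumes "\<forall>y\<in>set P. y < x \<or> y = N" "x < N" "successively (\<lambda>a b. a \<noteq> N \<or> b \<noteq> N) P"
  shows "cross x P + of_bool (P \<noteq> [] \<and> hd P = N) = count_list P N"
  using assms by (induction x P rule: cross.induct) auto

lemma gapped_0: "0 < N \<Longrightarrow> gapped N 0 = {[N]}"
proof (intro equalityI subsetI)
  fix w assume w: "w \<in> gapped N 0"
  then obtain w' where w': "w = N # w'"
    by (cases w) (auto simp: gapped_def)
  have "w' = []"
  proof (cases w')
    case (Cons b w'')
    then show ?thesis using w w' by (auto simp: gapped_def)
  qed
  then show "w \<in> {[N]}" using w' by simp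
qed (auto simp: gapped_def)

section \<open>Insertion of the next value as a bijection on gapped words\<close>

context
  fixes N i :: nat
  assumes N: "Suc i < N"
begin

lemma gapped_split:
  assumes "A @ N # B \<in> gapped N i"
  shows "A = [] \<or> hd A = N \<and> last A \<noteq> N" "B = [] \<or> hd B \<noteq> N"
    "successively (\<lambda>a b. a \<noteq> N \<or> b \<noteq> N) A" "successively (\<lambda>a b. a \<noteq> N \<or> b \<noteq> N) B"
    "set A \<union> set B \<union> {N} = insert N {1..i}"
    "distinct (filter (\<lambda>u. u \<noteq> N) A)" "distinct (filter (\<lambda>u. u \<noteq> N) B)"
    "set A \<inter> set B \<subseteq> {N}"
proof -
  have w: "hd (A @ N # B) = N" "successively (\<lambda>a b. a \<noteq> N \<or> b \<noteq> N) (A @ N # B)"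
    "distinct (filter (\<lambda>u. u \<noteq> N) (A @ N # B))" "set (A @ N # B) = insert N {1..i}"
    using assms unfolding gapped_def by blast+
  show "A = [] \<or> hd A = N \<and> last A \<noteq> N"
    using w(1,2) by (auto simp: successively_append_iff)
  show "B = [] \<or> hd B \<noteq> N"
    using w(2) by (auto simp: successively_append_iff successively_Cons)
  show "successively (\<lambda>a b. a \<noteq> N \<or> b \<noteq> N) A" "successively (\<lambda>a b. a \<noteq> N \<or> b \<noteq> N) B"
    using w(2) by (auto simp: successively_append_iff successively_Cons)
  show "set A \<union> set B \<union> {N} = insert N {1..i}"
    using w(4) by (simp add: Un_commute)
  show "distinct (filter (\<lambda>u. u \<noteq> N) A)" "distinct (filter (\<lambda>u. u \<noteq> N) B)"
    "set A \<inter> set B \<subseteq> {N}"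
    using w(3) by auto
qed

lemma fill_in_gapped:
  assumes "A @ N # B \<in> gapped N i" "A = [] \<longrightarrow> l"
  shows "fill N (Suc i) A B l r \<in> gapped N (Suc i)"
proof -
  note g = gapped_split[OF assms(1)]
  have S: "insert N {1..Suc i} = insert (Suc i) (set A \<union> set B \<union> {N})"
    unfolding g(5) by auto
  have x: "Suc i \<notin> set A" "Suc i \<notin> set B"
    using g(5) N by auto
  have d: "u = N" if "u \<in> set A" "u \<in> set B" for u
    using g(8) that by auto
  have NN: "N \<in> set A \<or> l"
    using g(1) assms(2) by (metis hd_in_set)
  show ?thesis
    unfolding gapped_def mem_Collect_eq S
    using g(1-4,6,7) assms(2) x N NN
    by (cases l; cases r)
      (auto simp: fill_def successively_append_iff successively_Cons hd_append dest: d)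
qed

text \<open>The inserted value is new, so the parts before and after it are determined. Since
  \<open>A\<close> does not end with a gap and \<open>B\<close> does not start with one, these parts
  show \<open>l\<close> and \<open>r\<close>.\<close>

lemma fill_inj:
  assumes "A @ N # B \<in> gapped N i" "A' @ N # B' \<in> gapped N i"
    and eq: "fill N (Suc i) A B l r = fill N (Suc i) A' B' l' r'"
  shows "A = A' \<and> B = B' \<and> l = l' \<and> r = r'"
proof -
  note g = gapped_split[OF assms(1)] gapped_split[OF assms(2)]
  have x: "Suc i \<notin> set (A @ gap N l)" "Suc i \<notin> set (A' @ gap N l')"
    using g(5,13) N by (auto simp: set_gap)
  have "before (Suc i) ((A @ gap N l) @ Suc i # gap N r @ B) =
        before (Suc i) ((A' @ gap N l') @ Suc i # gap N r' @ B')"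
    "after (Suc i) ((A @ gap N l) @ Suc i # gap N r @ B) =
        after (Suc i) ((A' @ gap N l') @ Suc i # gap N r' @ B')"
    using eq by (simp_all add: fill_def)
  then have 1: "A @ gap N l = A' @ gap N l'" "gap N r @ B = gap N r' @ B'"
    by (simp_all only: before_append_Cons[OF x(1)] before_append_Cons[OF x(2)]
        after_append_Cons[OF x(1)] after_append_Cons[OF x(2)])
  have "l = l'" using 1(1) g(1,9)
    by (cases l; cases l') (auto simp: gap_def)
  moreover have "r = r'" using 1(2) g(2,10)
    by (cases r; cases r') (auto simp: gap_def)
  ultimately show ?thesis using 1 by auto
qed

text \<open>The inverse of insertion: the largest value and the gaps next to it are merged into a
  single gap.\<close>

lemma gapped_Suc_fill:
  assumes "w \<in> gapped N (Suc i)"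
  obtains A B l r where "A @ N # B \<in> gapped N i" "A = [] \<longrightarrow> l" "w = fill N (Suc i) A B l r"
proof -
  have "Suc i \<in> set w" using assms by (auto simp: gapped_def)
  then obtain P Q where w: "w = P @ Suc i # Q" "Suc i \<notin> set P"
    by (meson split_list_first)
  define l where "l = (P \<noteq> [] \<and> last P = N)"
  define r where "r = (Q \<noteq> [] \<and> hd Q = N)"
  define A where "A = (if l then butlast P else P)"
  define B where "B = (if r then tl Q else Q)"
  have P: "P = A @ gap N l" and Q: "Q = gap N r @ B"
    by (auto simp: A_def B_def l_def r_def gap_def)
  have hP: "P \<noteq> []" "hd P = N"
    using assms w N by (auto simp: gapped_def hd_append split: if_splits)
  have xQ: "Suc i \<notin> set Q"
    using assms w N by (auto simp: gapped_def)
  have dis: "distinct (filter (\<lambda>u. u \<noteq> N) (P @ Q))"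
    using assms w N by (auto simp: gapped_def)
  have sc: "successively (\<lambda>a b. a \<noteq> N \<or> b \<noteq> N) P" "successively (\<lambda>a b. a \<noteq> N \<or> b \<noteq> N) Q"
    using assms w by (auto simp: gapped_def successively_append_iff successively_Cons)
  have set: "set P \<union> set Q = insert N {1..i}"
  proof -
    have "insert (Suc i) (set P \<union> set Q) = insert N {1..Suc i}"
      using assms w by (auto simp: gapped_def)
    then have "set P \<union> set Q = insert N {1..Suc i} - {Suc i}"
      using w(2) xQ by blast
    also have "\<dots> = insert N {1..i}" using N by auto
    finally show ?thesis .
  qed
  have scA: "successively (\<lambda>a b. a \<noteq> N \<or> b \<noteq> N) A" "A = [] \<or> hd A = N \<and> last A \<noteq> N"
  proof -
    have "A = [] \<or> last A \<noteq> N"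
      using sc(1) unfolding P by (cases l) (auto simp: successively_append_iff A_def l_def)
    moreover have "A = [] \<or> hd A = N" using hP unfolding P by (cases A) auto
    ultimately show "A = [] \<or> hd A = N \<and> last A \<noteq> N" by auto
  qed (use sc(1) P in \<open>auto simp: successively_append_iff\<close>)
  have scB: "successively (\<lambda>a b. a \<noteq> N \<or> b \<noteq> N) B" "B = [] \<or> hd B \<noteq> N"
  proof -
    show "B = [] \<or> hd B \<noteq> N"
      using sc(2) unfolding Q by (cases r) (auto simp: successively_Cons B_def r_def)
  qed (use sc(2) Q in \<open>auto simp: successively_append_iff\<close>)
  have "set (A @ N # B) = insert N (set P \<union> set Q)"
    by (auto simp: P Q set_gap)
  also have "\<dots> = insert N {1..i}"
    unfolding set by simp
  finally have S: "set (A @ N # B) = insert N {1..i}" .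
  have D: "filter (\<lambda>u. u \<noteq> N) (A @ N # B) = filter (\<lambda>u. u \<noteq> N) (P @ Q)"
    by (simp add: P Q gap_def)
  have "successively (\<lambda>a b. a \<noteq> N \<or> b \<noteq> N) (A @ N # B)"
    using scA scB by (simp add: successively_append_iff successively_Cons) blast
  moreover have "hd (A @ N # B) = N"
    using scA(2) by (cases A) auto
  ultimately have "A @ N # B \<in> gapped N i"
    unfolding gapped_def mem_Collect_eq D using S dis by blast
  moreover have "A = [] \<longrightarrow> l" using hP P by (cases l) auto
  ultimately show ?thesis
    using that w P Q by (simp add: fill_def)
qed

lemma gapped_Suc:
  "gapped N (Suc i) = (\<lambda>(w, (A, B), l, r). fill N (Suc i) A B l r) `
     (SIGMA w:gapped N i. SIGMA (A, B):splits N w. gap_choices A)"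
proof (intro equalityI subsetI)
  fix w assume "w \<in> gapped N (Suc i)"
  then obtain A B l r where "A @ N # B \<in> gapped N i" "A = [] \<longrightarrow> l" "w = fill N (Suc i) A B l r"
    by (rule gapped_Suc_fill)
  then show "w \<in> (\<lambda>(w, (A, B), l, r). fill N (Suc i) A B l r) `
     (SIGMA w:gapped N i. SIGMA (A, B):splits N w. gap_choices A)"
    by (intro image_eqI[of _ _ "(A @ N # B, (A, B), l, r)"]) (auto simp: splits_def gap_choices_def)
qed (auto simp: splits_def gap_choices_def intro: fill_in_gapped)

lemma sum_gapped_Suc:
  assumes fin: "finite (gapped N i)"
  shows "(\<Sum>w\<in>gapped N (Suc i). f w) =
    (\<Sum>w\<in>gapped N i. \<Sum>(A, B)\<in>splits N w. \<Sum>(l, r)\<in>gap_choices A. f (fill N (Suc i) A B l r))"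
proof -
  have "inj_on (\<lambda>(w, (A, B), l, r). fill N (Suc i) A B l r)
      (SIGMA w:gapped N i. SIGMA (A, B):splits N w. gap_choices A)"
  proof (intro inj_onI, clarsimp simp: splits_def)
    fix A B l r A' B' l' r'
    assume "A @ N # B \<in> gapped N i" "A' @ N # B' \<in> gapped N i"
      "fill N (Suc i) A B l r = fill N (Suc i) A' B' l' r'"
    then show "A @ N # B = A' @ N # B' \<and> A = A' \<and> B = B' \<and> l = l' \<and> r = r'"
      using fill_inj by blast
  qed
  then have "(\<Sum>w\<in>gapped N (Suc i). f w) =
      (\<Sum>(w, (A, B), l, r)\<in>(SIGMA w:gapped N i. SIGMA (A, B):splits N w. gap_choices A).
        f (fill N (Suc i) A B l r))"
    unfolding gapped_Suc by (simp add: sum.reindex comp_def case_prod_unfold)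
  also have "\<dots> = (\<Sum>w\<in>gapped N i. \<Sum>((A, B), l, r)\<in>(SIGMA (A, B):splits N w. gap_choices A).
        f (fill N (Suc i) A B l r))"
    using fin by (subst sum.Sigma) (auto simp: case_prod_unfold)
  also have "\<dots> = (\<Sum>w\<in>gapped N i. \<Sum>(A, B)\<in>splits N w. \<Sum>(l, r)\<in>gap_choices A.
        f (fill N (Suc i) A B l r))"
    by (intro sum.cong refl, simp add: case_prod_unfold, subst sum.Sigma)
      (auto simp: case_prod_unfold)
  finally show ?thesis .
qed

end

lemma finite_gapped: "i < N \<Longrightarrow> finite (gapped N i)"
proof (induction i)
  case (Suc i)
  then show ?case by (subst gapped_Suc) (auto intro!: finite_imageI finite_SigmaI)
qed (simp add: gapped_0)

text \<open>All values present are at most i, so \<open>i < end1 w\<close> says that the run of 1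
  ends with a gap. This gap is not counted in b, hence \<open>g - 1\<close>; the virtual gap is not
  counted in a.\<close>

definition state_sum :: "'a::comm_ring_1 \<Rightarrow> nat \<Rightarrow> nat \<Rightarrow> nat \<Rightarrow> nat list \<Rightarrow> 'a" where
  "state_sum q N m i w =
     (let a = count_list (before 1 w) N - 1; g = count_list (after 1 w) N in
      if i < end1 w then
        if marked (Suc i) w then marked_sum q m a (g - 1) else open_sum q m a (g - 1)
      else closed_sum q m a g)"

text \<open>The word behind 1 is scanned up to the first gap or the first descent, whichever comes
  first; a gap (\<open>ope\<close>) means that the run is still open.\<close>

lemma run_split_cases:
  assumes "a < N" "\<forall>y\<in>set Q. y \<le> N"
  shows "\<exists>R ope B. Q = R @ gap N ope @ B \<and> N \<notin> set R \<and> sorted (a # R) \<and>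
    (\<not> ope \<longrightarrow> B = [] \<or> hd B < last (a # R))"
  using assms
proof (induction Q arbitrary: a)
  case Nil
  then show ?case by (intro exI[of _ "[]"] exI[of _ False]) auto
next
  case (Cons b Q)
  consider "b < a" | "b = N" | "a \<le> b" "b < N"
    using Cons.prems by fastforce
  then show ?case
  proof cases
    case 1
    then show ?thesis by (intro exI[of _ "[]"] exI[of _ False] exI[of _ "b # Q"]) auto
  next
    case 2
    then show ?thesis by (intro exI[of _ "[]"] exI[of _ True] exI[of _ Q]) auto
  next
    case 3
    have "\<forall>y\<in>set Q. y \<le> N"
      using Cons.prems by simp
    from Cons.IH[OF 3(2) this] obtain R ope B where "Q = R @ gap N ope @ B" "N \<notin> set R" "sorted (b # R)"
        "\<not> ope \<longrightarrow> B = [] \<or> hd B < last (b # R)"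
      by blast
    then show ?thesis using 3
      by (intro exI[of _ "b # R"] exI[of _ ope] exI[of _ B]) auto
  qed
qed

lemma end1_append: "1 \<notin> set A \<Longrightarrow> sorted (1 # R) \<Longrightarrow> end1 (A @ 1 # R @ Q) = run_end (last (1 # R)) Q"
  by (metis end1_def after_append_Cons run_end_append_sorted)

lemma special_append:
  "1 \<notin> set A \<Longrightarrow> sorted (1 # R) \<Longrightarrow> \<forall>y\<in>set R. y \<le> c \<Longrightarrow>
     special c (A @ 1 # R @ Q) = lrmin_singleton_past c (last (1 # R)) Q"
  by (metis special_def after_append_Cons lrmin_singleton_past_append_sorted)

section \<open>Effect of one insertion on contribution and state\<close>

locale fill_gap =
  fixes N i :: nat and A B :: "nat list" and l r :: bool
  assumes N: "Suc i < N" and i: "1 \<le> i"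
    and w: "A @ N # B \<in> gapped N i" and l: "A = [] \<longrightarrow> l"
begin

abbreviation w where "w \<equiv> A @ N # B"
abbreviation w' where "w' \<equiv> fill N (Suc i) A B l r"

lemmas g = gapped_split[OF N w]

lemma w'_eq: "w' = (A @ gap N l) @ Suc i # (gap N r @ B)"
  by (simp add: fill_def)

lemma letters: "y \<in> set A \<union> set B \<Longrightarrow> y \<noteq> N \<Longrightarrow> y \<le> i"
  using g(5) by auto

lemma x_notin: "Suc i \<notin> set A" "Suc i \<notin> set B" "Suc i \<notin> set (A @ gap N l)" "Suc i \<notin> set (gap N r @ B)"
  using letters[of "Suc i"] N by (auto simp: set_gap)

lemma before_x: "before (Suc i) w' = A @ gap N l"
  unfolding w'_eq using x_notin(3) by (rule before_append_Cons)

lemma after_x: "after (Suc i) w' = gap N r @ B"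
  unfolding w'_eq using x_notin(3) by (rule after_append_Cons)

lemma opens_x: "Suc i < last (before (Suc i) w') \<longleftrightarrow> l"
proof (cases l)
  case False
  then have "A \<noteq> []" "last A \<noteq> N" using l g(1) by auto
  then have "last A \<le> i" using letters[of "last A"] by simp
  then show ?thesis unfolding before_x using False by simp
qed (use N in \<open>unfold before_x, simp\<close>)

lemma rises_x: "rises (Suc i) w' \<longleftrightarrow> r"
proof (cases r)
  case False
  have "B = [] \<or> hd B \<le> i" using letters[of "hd B"] g(2) by (cases B) auto
  then show ?thesis unfolding rises_def after_x using False by auto
qed (use N in \<open>unfold rises_def after_x, simp\<close>)

lemma cross_before: "cross (Suc i) (A @ gap N l) = count_list A N + of_bool l - 1"
proof -
  have "successively (\<lambda>a b. a \<noteq> N \<or> b \<noteq> N) (A @ gap N l)"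
    using g(1,3) by (auto simp: successively_append_iff gap_def)
  moreover have "\<forall>y\<in>set (A @ gap N l). y < Suc i \<or> y = N"
    using letters by (auto simp: set_gap less_Suc_eq_le split: if_splits)
  moreover have "A @ gap N l \<noteq> [] \<and> hd (A @ gap N l) = N"
    using g(1) l by (cases "A = []") (auto simp: gap_def)
  ultimately show ?thesis
    using cross_eq_count[of "A @ gap N l" "Suc i" N] N by simp
qed

lemma cross_after: "cross (Suc i) (gap N r @ B) = count_list B N"
proof -
  have "cross (Suc i) (gap N r @ B) = cross (Suc i) B"
    using N by (cases r) (auto simp: cross_Cons_ge)
  moreover have "\<forall>y\<in>set B. y < Suc i \<or> y = N"
    using letters by (auto simp: less_Suc_eq_le)
  ultimately show ?thesis
    using cross_eq_count[of B "Suc i" N] N g(2,4) by auto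
qed

lemma one_mem: "1 \<in> set (A @ B)"
  using g(5) i N by auto

lemma refill_eq: "w' = A @ (gap N l @ Suc i # gap N r) @ B" "w = A @ [N] @ B"
  by (simp_all add: fill_def)

lemma end1_w': "i < end1 w' \<longleftrightarrow> i < end1 w"
  unfolding refill_eq using N i one_mem by (intro end1_refill) (auto simp: set_gap)

lemma special_w': "1 \<le> c \<Longrightarrow> c \<le> i \<Longrightarrow> special c w' \<longleftrightarrow> special c w"
  unfolding refill_eq using N i one_mem by (intro special_refill[where v = i]) (auto simp: set_gap)

lemma marked_w': "marked (Suc i) w' \<longleftrightarrow> marked (Suc i) w"
  unfolding marked_def using special_w' by (intro bex_cong) auto

lemma marked_Suc_w': "marked (Suc (Suc i)) w' \<longleftrightarrow> marked (Suc i) w \<or> special (Suc i) w'"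
proof -
  have "{1..<Suc (Suc i)} = insert (Suc i) {1..<Suc i}" by auto
  then show ?thesis using marked_w' unfolding marked_def by auto
qed

text \<open>For the value just inserted, the ascents over it are gaps, the virtual one excepted, so
  its contribution is a matter of counting gaps. The mark weight is read off from the word before
  the insertion.\<close>

lemma contrib_x:
  "contrib (Suc i) w' = of_bool l
     + 2 * (if 1 \<in> set A then
              if r then count_list A N + of_bool l - 1 + of_bool (\<not> Suc i < end1 w')
              else count_list A N + of_bool l - 1 - of_bool (Suc i < end1 w')
            else count_list A N + of_bool l - 1)
     + (if 1 \<in> set B then
          if r then count_list B N + of_bool (\<not> Suc i < end1 w')
          else count_list B N - of_bool (Suc i < end1 w')
        else count_list B N)
     + (if i < end1 w \<and> marked (Suc i) w then if 1 \<in> set B then 1 else 2 else 0)"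
proof -
  have "1 \<in> set (A @ gap N l) \<longleftrightarrow> 1 \<in> set A" "1 \<in> set (gap N r @ B) \<longleftrightarrow> 1 \<in> set B"
    using N i by (auto simp: set_gap)
  then show ?thesis
    unfolding contrib_def side_count_def mark_weight_def opens_x rises_x
    unfolding before_x after_x cross_before cross_after
    by (simp add: end1_w' marked_w')
qed

end

locale split_at_run1 =
  fixes N i :: nat and A0 R B0 :: "nat list" and ope :: bool
  assumes N: "Suc i < N" and i: "1 \<le> i"
    and w: "A0 @ 1 # R @ gap N ope @ B0 \<in> gapped N i"
    and R: "sorted (1 # R)" "N \<notin> set R"
    and B0: "\<not> ope \<longrightarrow> B0 = [] \<or> hd B0 < last (1 # R)"
begin

abbreviation w where "w \<equiv> A0 @ 1 # R @ gap N ope @ B0"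

lemma one: "1 \<notin> set A0" "1 \<notin> set R" "1 \<notin> set B0"
proof -
  have "distinct (filter (\<lambda>u. u \<noteq> N) w)"
    using w unfolding gapped_def by blast
  then show "1 \<notin> set A0" "1 \<notin> set R" "1 \<notin> set B0"
    using N i by auto
qed

lemma set_w: "set w = insert N {1..i}"
  using w unfolding gapped_def by blast

lemma letters: "y \<in> set A0 \<union> set R \<union> set B0 \<Longrightarrow> y \<noteq> N \<Longrightarrow> y \<le> i"
  using set_w by auto

lemma letters_le_N: "y \<in> set A0 \<union> set R \<union> set B0 \<Longrightarrow> y \<le> N"
  using letters[of y] N by force

lemma R_le: "\<forall>y\<in>set (1 # R). y \<le> i"
  using letters R i by auto

lemma R_le_Suc: "\<forall>y\<in>set R. y \<le> Suc i"
  using R_le by auto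

lemma last_le: "last (1 # R) \<le> i"
  using R_le last_in_set[of "1 # R"] by blast

lemma A0: "A0 \<noteq> []" "hd A0 = N"
proof -
  have "hd w = N" using w unfolding gapped_def by blast
  then show "A0 \<noteq> []" "hd A0 = N" using N i by (auto simp: hd_append split: if_splits)
qed

lemma count_A0: "1 \<le> count_list A0 N"
  using A0 by (cases A0) auto

lemma count_R [simp]: "count_list R N = 0"
  using R by (simp add: count_list_0_iff)

lemma end1_tail:
  assumes "1 \<notin> set A'" "\<forall>y\<in>set Q. y \<le> N"
  shows "end1 (A' @ 1 # R @ N # Q) = N"
proof -
  have "end1 (A' @ 1 # R @ N # Q) = run_end (last (1 # R)) (N # Q)"
    using end1_append[OF assms(1) R(1)] .
  also have "\<dots> = N"
    using last_le N run_end_max[OF assms(2)] by simp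
  finally show ?thesis .
qed

lemma end1_closed:
  assumes "1 \<notin> set A'" "Q = [] \<or> hd Q < last (1 # R)"
  shows "end1 (A' @ 1 # R @ Q) = last (1 # R)"
  using end1_append[OF assms(1) R(1), of Q] assms(2) by (cases Q) auto

lemma end1_w: "end1 w = (if ope then N else last (1 # R))"
proof (cases ope)
  case True
  then show ?thesis using end1_tail[of A0 B0] one letters_le_N by simp
next
  case False
  then show ?thesis using end1_closed[of A0 B0] one B0 by simp
qed

lemma open_iff: "i < end1 w \<longleftrightarrow> ope"
  using end1_w last_le N by auto

abbreviation "a \<equiv> count_list A0 N - 1"
abbreviation "b \<equiv> count_list B0 N"

abbreviation "mark \<equiv> (of_bool (ope \<and> marked (Suc i) w) :: nat)"

definition state :: "'a::comm_ring_1 \<Rightarrow> nat \<Rightarrow> nat \<Rightarrow> nat \<Rightarrow> 'a" where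
  "state q m = (if ope then if marked (Suc i) w then marked_sum q m else open_sum q m
    else closed_sum q m)"

lemma state_sum_w: "state_sum q N m i w = state q m a b"
proof -
  have "before 1 w = A0" "after 1 w = R @ gap N ope @ B0"
    using one by simp_all
  then show ?thesis
    unfolding state_sum_def open_iff by (simp add: state_def)
qed

text \<open>Nothing changes behind 1, so b and the kind of state persist. The run of 1 adds exactly
  \<open>of_bool r\<close> to the right-hand count, open or closed: \<open>side_count\<close> keeps
  or cancels the gap of an open run, and adds a closed run in the rising case.\<close>

lemma fill_left:
  fixes r :: bool
  assumes A: "A0 = A @ N # A2" and l: "A = [] \<longrightarrow> l"
  defines "w' \<equiv> fill N (Suc i) A (A2 @ 1 # R @ gap N ope @ B0) l r"
  shows "contrib (Suc i) w' = of_bool l + 2 * (count_list A N + of_bool l - 1)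
      + (count_list A2 N + b + of_bool r) + mark"
    and "state_sum q N m (Suc i) w' =
      state q m (count_list A N + count_list A2 N + of_bool l + of_bool r - 1) b"
proof -
  interpret F: fill_gap N i A "A2 @ 1 # R @ gap N ope @ B0" l r
    using N i w A l by unfold_locales auto
  have ww: "F.w = w" using A by simp
  have w': "w' = (A @ gap N l @ Suc i # gap N r @ A2) @ 1 # (R @ gap N ope @ B0)"
    by (simp add: w'_def fill_def)
  have n1: "1 \<notin> set (A @ gap N l @ Suc i # gap N r @ A2)"
    using one A i N by (auto simp: set_gap)
  have bef: "before 1 w' = A @ gap N l @ Suc i # gap N r @ A2" and aft: "after 1 w' = R @ gap N ope @ B0"
    unfolding w' using before_append_Cons[OF n1] after_append_Cons[OF n1] by blast+
  have "after 1 w = after 1 w'"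
    using aft one by simp
  then have e: "end1 w' = end1 w"
    by (simp add: end1_def)
  have x: "Suc i < end1 w' \<longleftrightarrow> ope"
    unfolding e end1_w using last_le N by auto
  have sp: "\<not> special (Suc i) w'"
  proof -
    have "Suc i \<notin> set (R @ gap N ope @ B0)"
      using letters[of "Suc i"] N by (auto simp: set_gap)
    then show ?thesis
      unfolding special_def aft using lrmin_singleton_past_mem by blast
  qed
  have m: "marked (Suc (Suc i)) w' = marked (Suc i) w"
    using F.marked_Suc_w' sp A by (simp add: w'_def)
  have 1: "1 \<notin> set A" using one A by auto
  show "contrib (Suc i) w' = of_bool l + 2 * (count_list A N + of_bool l - 1)
      + (count_list A2 N + b + of_bool r) + mark"
    using F.contrib_x[folded w'_def, unfolded ww open_iff x] 1 N i by auto
  show "state_sum q N m (Suc i) w' =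
      state q m (count_list A N + count_list A2 N + of_bool l + of_bool r - 1) b"
    unfolding state_sum_def x bef aft m using N by (simp add: state_def add_ac)
qed

text \<open>The run of 1 again adds \<open>of_bool r\<close>, now to the left-hand count. No mark
  arises: behind the gap of an open run stands a smaller value, so the new value is not a
  left-to-right minimum there.\<close>

lemma fill_right:
  fixes l r :: bool
  assumes B: "B0 = B1 @ N # B2"
  defines "w' \<equiv> fill N (Suc i) (A0 @ 1 # R @ gap N ope @ B1) B2 l r"
  shows "contrib (Suc i) w' = of_bool l + 2 * (a + count_list B1 N + of_bool l + of_bool r)
      + count_list B2 N + 2 * mark"
    and "state_sum q N m (Suc i) w' =
      state q m a (count_list B1 N + count_list B2 N + of_bool l + of_bool r)"
proof -
  interpret F: fill_gap N i "A0 @ 1 # R @ gap N ope @ B1" B2 l r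
    using N i w B by unfold_locales auto
  have ww: "F.w = w" using B by simp
  define T where "T = B1 @ gap N l @ Suc i # gap N r @ B2"
  have w': "w' = A0 @ 1 # (R @ gap N ope @ T)"
    by (simp add: w'_def fill_def T_def)
  have bef: "before 1 w' = A0" and aft: "after 1 w' = R @ gap N ope @ T"
    unfolding w' using before_append_Cons[OF one(1)] after_append_Cons[OF one(1)] by blast+
  have B1: "B1 \<noteq> []" if ope
    using F.g(1) that by auto
  \<comment> \<open>\<open>B0\<close> starts below the last element of the closed run, so its head
    is not the chosen gap and still ends the run after the insertion.\<close>
  have B1': "B1 \<noteq> []" "hd B1 < last (1 # R)" if "\<not> ope"
    using B0 that B last_le N by (cases B1; auto)+
  have e: "end1 w' = end1 w"
  proof (cases ope)
    case True
    have "\<forall>y\<in>set T. y \<le> N"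
      using letters_le_N B N by (auto simp: T_def set_gap)
    then show ?thesis unfolding end1_w w' using True end1_tail[OF one(1), of T] by simp
  next
    case False
    then have "hd T < last (1 # R)" using B1' by (simp add: T_def)
    then show ?thesis unfolding end1_w w' using False end1_closed[OF one(1), of T] by simp
  qed
  have x: "Suc i < end1 w' \<longleftrightarrow> ope"
    unfolding e end1_w using last_le N by auto
  have sp: "\<not> special (Suc i) w'" if ope
  proof -
    have "hd B1 \<noteq> N"
      using F.g(3) B1 that by (auto simp: successively_append_iff successively_Cons)
    then have h: "hd B1 < Suc i"
      using letters[of "hd B1"] B B1 that by (cases B1) auto
    have "special (Suc i) w' \<longleftrightarrow> lrmin_singleton_past (Suc i) (last (1 # R)) (N # T)"
      unfolding w' using that special_append[OF one(1) R(1) R_le_Suc, of "N # T"] by simp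
    also have "\<dots> \<longleftrightarrow> False"
      using last_le N h B1 that by (cases B1) (auto simp: T_def)
    finally show ?thesis by simp
  qed
  have m: "marked (Suc (Suc i)) w' = marked (Suc i) w" if ope
    using F.marked_Suc_w' sp that B by (simp add: w'_def)
  have 1: "1 \<notin> set B2" using one B by auto
  have cA: "count_list A0 N = Suc a" using count_A0 by simp
  show "contrib (Suc i) w' = of_bool l + 2 * (a + count_list B1 N + of_bool l + of_bool r)
      + count_list B2 N + 2 * mark"
    using F.contrib_x[folded w'_def, unfolded ww open_iff x] 1 N i cA by auto
  show "state_sum q N m (Suc i) w' =
      state q m a (count_list B1 N + count_list B2 N + of_bool l + of_bool r)"
    unfolding state_sum_def x bef aft using N m by (simp add: state_def add_ac T_def)
qed

text \<open>A closer or continuator joins the run of 1, a singleton does not count that run, and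
  only an opener does. The opener also leaves one new gap on the right, while the gap before it
  continues to end the run of 1.\<close>

lemma fill_middle:
  fixes l r :: bool
  assumes ope
  defines "w' \<equiv> fill N (Suc i) (A0 @ 1 # R) B0 l r"
  shows "contrib (Suc i) w' = of_bool l + 2 * (a + of_bool (l \<and> r)) + b + 2 * mark"
    and "state_sum q N m (Suc i) w' =
      (if l then if r then state q m a (Suc b) else marked_sum q m a b
       else if r then state q m a b else closed_sum q m a b)"
proof -
  interpret F: fill_gap N i "A0 @ 1 # R" B0 l r
    using N i w \<open>ope\<close> by unfold_locales auto
  have ww: "F.w = w" using \<open>ope\<close> by simp
  define T where "T = gap N l @ Suc i # gap N r @ B0"
  have w': "w' = A0 @ 1 # (R @ T)"
    by (simp add: w'_def fill_def T_def)
  have bef: "before 1 w' = A0" and aft: "after 1 w' = R @ T"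
    unfolding w' using before_append_Cons[OF one(1)] after_append_Cons[OF one(1)] by blast+
  have B: "\<forall>y\<in>set B0. y \<le> N" using letters_le_N by auto
  have hB: "B0 = [] \<or> hd B0 < Suc i"
    using F.g(2) letters[of "hd B0"] by (cases B0) auto
  have "end1 w' = run_end (last (1 # R)) T"
    unfolding w' using end1_append[OF one(1) R(1)] .
  also have "\<dots> = (if l \<or> r then N else Suc i)"
  proof -
    have "run_end (Suc i) B0 = Suc i" using hB by (cases B0) auto
    moreover have "run_end N (Suc i # gap N r @ B0) = N"
      using B N by (intro run_end_max) (auto simp: set_gap)
    ultimately show ?thesis
      using last_le N run_end_max[OF B] by (cases l; cases r) (auto simp: T_def)
  qed
  finally have e: "end1 w' = (if l \<or> r then N else Suc i)" .
  have x: "Suc i < end1 w' \<longleftrightarrow> l \<or> r"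
    unfolding e using N by auto
  \<comment> \<open>Behind a surviving gap the new value is the first letter after the run of 1; it
    is special precisely when no larger letter follows. Without that gap it belongs to the
    run.\<close>
  have "special (Suc i) w' \<longleftrightarrow> lrmin_singleton_past (Suc i) (last (1 # R)) T"
    unfolding w' using special_append[OF one(1) R(1) R_le_Suc] .
  also have "\<dots> \<longleftrightarrow> l \<and> \<not> r"
  proof (cases l)
    case True
    then show ?thesis using last_le N hB by (cases r) (auto simp: T_def)
  next
    case False
    have "Suc i \<notin> set (gap N r @ B0)"
      using F.x_notin by blast
    then show ?thesis
      using False last_le lrmin_singleton_past_mem[of "Suc i" "Suc i" "gap N r @ B0"]
      by (auto simp: T_def)
  qed
  finally have m: "marked (Suc (Suc i)) w' \<longleftrightarrow> marked (Suc i) w \<or> (l \<and> \<not> r)"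
    using F.marked_Suc_w' \<open>ope\<close> by (simp add: w'_def)
  have cA: "count_list A0 N = Suc a" using count_A0 by simp
  show "contrib (Suc i) w' = of_bool l + 2 * (a + of_bool (l \<and> r)) + b + 2 * mark"
    using F.contrib_x[folded w'_def, unfolded ww open_iff x] one N i cA \<open>ope\<close> by auto
  show "state_sum q N m (Suc i) w' =
      (if l then if r then state q m a (Suc b) else marked_sum q m a b
       else if r then state q m a b else closed_sum q m a b)"
    unfolding state_sum_def x bef aft m state_def Let_def using N \<open>ope\<close> by (simp add: T_def)
qed

end

section \<open>Summation over the gaps of one word\<close>

lemma sum_power_shift: "(\<Sum>j<n. q ^ (e + j) * x) = q ^ e * qint n q * x" for x :: "'a::comm_ring_1"
  by (simp add: qint_def power_add sum_distrib_left sum_distrib_right mult.assoc)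

text \<open>Here j is the number of gaps to the left of the chosen one. Since 2j + (a - j) = a + j,
  each of the four cases is a geometric sum; j = 0 is the virtual gap, which admits no closer and no
  continuator.\<close>

lemma sum_left_gaps:
  fixes q :: "'a::comm_ring_1"
  shows "(\<Sum>j<Suc a. q ^ (1 + 2 * j + (a - j + b + 1) + e) * x
        + q ^ (1 + 2 * j + (a - j + b) + e) * y
        + (if j = 0 then 0 else q ^ (2 * (j - 1) + (a - j + b + 1) + e) * y
            + q ^ (2 * (j - 1) + (a - j + b) + e) * z)) =
    q ^ e * (q ^ (a + b - 1) * qint a q * z + q ^ (a + b) * qint a q * y
      + q ^ (a + b + 1) * qint (Suc a) q * y + q ^ (a + b + 2) * qint (Suc a) q * x)"
proof -
  have "(\<Sum>j<Suc a. q ^ (1 + 2 * j + (a - j + b + 1) + e) * x) = (\<Sum>j<Suc a. q ^ (a + b + 2 + e + j) * x)"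
    by (intro sum.cong arg_cong2[where f = "(*)"] arg_cong2[where f = "(^)"]) auto
  moreover have "(\<Sum>j<Suc a. q ^ (1 + 2 * j + (a - j + b) + e) * y) = (\<Sum>j<Suc a. q ^ (a + b + 1 + e + j) * y)"
    by (intro sum.cong arg_cong2[where f = "(*)"] arg_cong2[where f = "(^)"]) auto
  moreover have "(\<Sum>j<a. q ^ (2 * j + (a - Suc j + b + 1) + e) * y) = (\<Sum>j<a. q ^ (a + b + e + j) * y)"
    by (intro sum.cong arg_cong2[where f = "(*)"] arg_cong2[where f = "(^)"]) auto
  moreover have "(\<Sum>j<a. q ^ (2 * j + (a - Suc j + b) + e) * z) = (\<Sum>j<a. q ^ (a + b - 1 + e + j) * z)"
    by (intro sum.cong arg_cong2[where f = "(*)"] arg_cong2[where f = "(^)"]) auto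
  moreover have "(\<Sum>j<Suc a. if j = 0 then 0 else q ^ (2 * (j - 1) + (a - j + b + 1) + e) * y
            + q ^ (2 * (j - 1) + (a - j + b) + e) * z) =
      (\<Sum>j<a. q ^ (2 * j + (a - Suc j + b + 1) + e) * y) + (\<Sum>j<a. q ^ (2 * j + (a - Suc j + b) + e) * z)"
    unfolding sum.lessThan_Suc_shift by (simp add: sum.distrib)
  ultimately show ?thesis
    unfolding sum.distrib by (simp only: sum_power_shift) (simp add: power_add algebra_simps)
qed

lemma sum_right_gaps:
  fixes q :: "'a::comm_ring_1"
  shows "(\<Sum>j<b. q ^ (1 + 2 * (a + j + 1 + 1) + (b - 1 - j) + e) * x
        + q ^ (1 + 2 * (a + j + 1) + (b - 1 - j) + e) * y
        + (q ^ (2 * (a + j + 1) + (b - 1 - j) + e) * y + q ^ (2 * (a + j) + (b - 1 - j) + e) * z)) =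
    q ^ e * (q ^ (2 * a + b - 1) * qint b q * z
      + (q ^ (2 * a + b + 1) + q ^ (2 * a + b + 2)) * qint b q * y
      + q ^ (2 * a + b + 4) * qint b q * x)"
proof -
  have "(\<Sum>j<b. q ^ (1 + 2 * (a + j + 1 + 1) + (b - 1 - j) + e) * x) = (\<Sum>j<b. q ^ (2 * a + b + 4 + e + j) * x)"
    by (intro sum.cong arg_cong2[where f = "(*)"] arg_cong2[where f = "(^)"]) auto
  moreover have "(\<Sum>j<b. q ^ (1 + 2 * (a + j + 1) + (b - 1 - j) + e) * y) = (\<Sum>j<b. q ^ (2 * a + b + 2 + e + j) * y)"
    by (intro sum.cong arg_cong2[where f = "(*)"] arg_cong2[where f = "(^)"]) auto
  moreover have "(\<Sum>j<b. q ^ (2 * (a + j + 1) + (b - 1 - j) + e) * y) = (\<Sum>j<b. q ^ (2 * a + b + 1 + e + j) * y)"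
    by (intro sum.cong arg_cong2[where f = "(*)"] arg_cong2[where f = "(^)"]) auto
  moreover have "(\<Sum>j<b. q ^ (2 * (a + j) + (b - 1 - j) + e) * z) = (\<Sum>j<b. q ^ (2 * a + b - 1 + e + j) * z)"
    by (intro sum.cong arg_cong2[where f = "(*)"] arg_cong2[where f = "(^)"]) auto
  ultimately show ?thesis
    unfolding sum.distrib by (simp only: sum_power_shift) (simp add: power_add algebra_simps)
qed

context split_at_run1
begin

text \<open>Common form of the three recursions; \<open>mark\<close> is 1 in the marked state and 0
  in the others.\<close>

lemma state_Suc:
  "state q (Suc m) a b =
     fill_step q (q ^ mark) (q ^ (2 * mark)) (state q m) a b
     + (if ope then q ^ (2 * mark) * (q ^ (2 * a + b) * closed_sum q m a b
          + q ^ (2 * a + b + 1) * marked_sum q m a b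
          + q ^ (2 * a + b) * state q m a b
          + q ^ (2 * a + b + 3) * state q m a (Suc b)) else 0)"
  unfolding state_def by simp

text \<open>As 1 and \<open>R\<close> contain no gap, the gaps fall into those left of 1, possibly
  the one ending the run of 1, and those to its right. These give the three groups of terms of
  \<open>state_Suc\<close>.\<close>

lemma state_sum_Suc:
  "(\<Sum>(A, B)\<in>splits N w. \<Sum>(l, r)\<in>gap_choices A.
      q ^ contrib (Suc i) (fill N (Suc i) A B l r) * state_sum q N m (Suc i) (fill N (Suc i) A B l r))
    = state_sum q N (Suc m) i w"
proof -
  define f where "f A B = (\<Sum>(l, r)\<in>gap_choices A.
      q ^ contrib (Suc i) (fill N (Suc i) A B l r) * state_sum q N m (Suc i) (fill N (Suc i) A B l r))"
    for A B
  define x y z where "x = state q m (Suc a) b" and "y = state q m a b" and "z = state q m (a - 1) b"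
  define h where "h j = q ^ (1 + 2 * j + (a - j + b + 1) + mark) * x
        + q ^ (1 + 2 * j + (a - j + b) + mark) * y
        + (if j = 0 then 0 else q ^ (2 * (j - 1) + (a - j + b + 1) + mark) * y
            + q ^ (2 * (j - 1) + (a - j + b) + mark) * z)" for j
  have "(\<Sum>(A, A2)\<in>splits N A0. f A (A2 @ 1 # R @ gap N ope @ B0)) =
      (\<Sum>(A, A2)\<in>splits N A0. h (count_list A N))"
  proof (intro sum.cong refl, clarify)
    fix A A2 assume "(A, A2) \<in> splits N A0"
    then have A: "A0 = A @ N # A2" by (simp add: splits_def)
    \<comment> \<open>Only the virtual gap has no gap in front of it, so the restriction in
      \<open>gap_choices\<close> becomes the case j = 0 of \<open>h\<close>.\<close>
    have A': "A = [] \<longleftrightarrow> count_list A N = 0"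
      using A0(2) A by (cases A) auto
    have a: "a = count_list A N + count_list A2 N"
      using A by simp
    define T where "T = A2 @ 1 # R @ gap N ope @ B0"
    define e where "e = mark"
    have c: "contrib (Suc i) (fill N (Suc i) A T l r) =
        of_bool l + 2 * (count_list A N + of_bool l - 1) + (count_list A2 N + b + of_bool r) + e"
      "state_sum q N m (Suc i) (fill N (Suc i) A T l r) = state q m (a + of_bool l + of_bool r - 1) b"
      if "A = [] \<longrightarrow> l" for l r
      by (simp_all only: a T_def e_def fill_left[OF A that])
    show "f A (A2 @ 1 # R @ gap N ope @ B0) = h (count_list A N)"
      unfolding f_def h_def sum_gap_choices T_def[symmetric] e_def[symmetric] x_def y_def z_def a A'
      by (cases "count_list A N = 0") (simp_all add: c[unfolded A' a])
  qed
  also have "\<dots> = q ^ mark * (q ^ (a + b - 1) * qint a q * z + q ^ (a + b) * qint a q * y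
      + q ^ (a + b + 1) * qint (Suc a) q * y + q ^ (a + b + 2) * qint (Suc a) q * x)"
  proof -
    have "(\<Sum>(A, A2)\<in>splits N A0. h (count_list A N)) = (\<Sum>j<Suc a. h j)"
      unfolding sum_splits_count[of h] using count_A0 by simp
    then show ?thesis
      using sum_left_gaps[of q a b mark x y z] unfolding h_def by (rule trans)
  qed
  finally have left: "(\<Sum>(A, A2)\<in>splits N A0. f A (A2 @ 1 # R @ gap N ope @ B0)) =
      q ^ mark * (q ^ (a + b - 1) * qint a q * z + q ^ (a + b) * qint a q * y
      + q ^ (a + b + 1) * qint (Suc a) q * y + q ^ (a + b + 2) * qint (Suc a) q * x)" .
  define x' z' where "x' = state q m a (Suc b)" and "z' = state q m a (b - 1)"
  define h' where "h' j = q ^ (1 + 2 * (a + j + 1 + 1) + (b - 1 - j) + 2 * mark) * x'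
        + q ^ (1 + 2 * (a + j + 1) + (b - 1 - j) + 2 * mark) * y
        + (q ^ (2 * (a + j + 1) + (b - 1 - j) + 2 * mark) * y
            + q ^ (2 * (a + j) + (b - 1 - j) + 2 * mark) * z')" for j
  have "(\<Sum>(B1, B2)\<in>splits N B0. f (A0 @ 1 # R @ gap N ope @ B1) B2) =
      (\<Sum>(B1, B2)\<in>splits N B0. h' (count_list B1 N))"
  proof (intro sum.cong refl, clarify)
    fix B1 B2 assume "(B1, B2) \<in> splits N B0"
    then have B: "B0 = B1 @ N # B2" by (simp add: splits_def)
    have b: "b = Suc (count_list B1 N + count_list B2 N)"
      using B by simp
    show "f (A0 @ 1 # R @ gap N ope @ B1) B2 =
       h' (count_list B1 N)"
      unfolding f_def h'_def sum_gap_choices fill_right[OF B] x'_def y_def z'_def b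
      using A0 by simp
  qed
  also have "\<dots> = q ^ (2 * mark) * (q ^ (2 * a + b - 1) * qint b q * z'
      + (q ^ (2 * a + b + 1) + q ^ (2 * a + b + 2)) * qint b q * y
      + q ^ (2 * a + b + 4) * qint b q * x')"
    unfolding sum_splits_count[of h'] unfolding h'_def by (rule sum_right_gaps)
  finally have right: "(\<Sum>(B1, B2)\<in>splits N B0. f (A0 @ 1 # R @ gap N ope @ B1) B2) =
      q ^ (2 * mark) * (q ^ (2 * a + b - 1) * qint b q * z'
      + (q ^ (2 * a + b + 1) + q ^ (2 * a + b + 2)) * qint b q * y
      + q ^ (2 * a + b + 4) * qint b q * x')" .
  have middle: "(\<Sum>(B1, B2)\<in>splits N (gap N ope). f (A0 @ 1 # R @ B1) (B2 @ B0)) =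
      (if ope then q ^ (2 * mark) * (q ^ (2 * a + b) * closed_sum q m a b
          + q ^ (2 * a + b + 1) * marked_sum q m a b
          + q ^ (2 * a + b) * y
          + q ^ (2 * a + b + 3) * x') else 0)"
  proof (cases ope)
    case True
    have "splits N [N] = {([], [])}"
      by (auto simp: splits_Cons)
    then have "(\<Sum>(B1, B2)\<in>splits N (gap N ope). f (A0 @ 1 # R @ B1) (B2 @ B0)) = f (A0 @ 1 # R) B0"
      using True by simp
    also have "\<dots> = q ^ (2 * mark) * (q ^ (2 * a + b) * closed_sum q m a b
          + q ^ (2 * a + b + 1) * marked_sum q m a b
          + q ^ (2 * a + b) * y
          + q ^ (2 * a + b + 3) * x')"
      unfolding f_def sum_gap_choices fill_middle[OF True] x'_def y_def
      by (simp add: power_add algebra_simps numeral_eq_Suc)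
    finally show ?thesis using True by simp
  qed simp
  have N1: "splits N [1] = {}" "splits N R = {}"
    using N i R by (simp_all add: splits_not_mem)
  have "(\<Sum>(A, B)\<in>splits N w. f A B) = (\<Sum>(A, B)\<in>splits N (A0 @ [1] @ R @ gap N ope @ B0). f A B)"
    by simp
  also have "\<dots> = (\<Sum>(A, A2)\<in>splits N A0. f A (A2 @ 1 # R @ gap N ope @ B0))
      + ((\<Sum>(B1, B2)\<in>splits N (gap N ope). f (A0 @ 1 # R @ B1) (B2 @ B0))
      + (\<Sum>(B1, B2)\<in>splits N B0. f (A0 @ 1 # R @ gap N ope @ B1) B2))"
    unfolding sum_splits_append N1 by simp
  also have "\<dots> = state q (Suc m) a b"
    unfolding left middle right state_Suc fill_step_def x_def y_def z_def x'_def z'_def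
    by (simp only: add_ac)
  finally show ?thesis
    unfolding f_def state_sum_w .
qed

end

section \<open>Summation over all gapped words\<close>

lemma sum_fill_state:
  assumes "Suc i < N" "1 \<le> i" "w \<in> gapped N i"
  shows "(\<Sum>(A, B)\<in>splits N w. \<Sum>(l, r)\<in>gap_choices A.
      q ^ contrib (Suc i) (fill N (Suc i) A B l r) * state_sum q N m (Suc i) (fill N (Suc i) A B l r))
    = state_sum q N (Suc m) i w"
proof -
  have "1 \<in> set w" and le: "\<forall>y\<in>set w. y \<le> N"
    using assms by (auto simp: gapped_def)
  then obtain A0 Q where wA: "w = A0 @ 1 # Q"
    by (meson split_list)
  obtain R ope B0 where "Q = R @ gap N ope @ B0" "N \<notin> set R" "sorted (1 # R)"
      "\<not> ope \<longrightarrow> B0 = [] \<or> hd B0 < last (1 # R)"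
    using run_split_cases[of 1 N Q] assms wA le by auto
  then interpret split_at_run1 N i A0 R B0 ope
    using assms wA by unfold_locales auto
  show ?thesis
    using state_sum_Suc[of q m] unfolding wA \<open>Q = _\<close> .
qed

text \<open>The sum starts at 2: the value 1 contributes exactly 1, which is the run subtracted in
  \<open>nruns s - 1\<close>.\<close>

definition total :: "nat \<Rightarrow> nat list \<Rightarrow> nat" where
  "total i w = (\<Sum>v=2..i. contrib v w)"

text \<open>The earlier values see the gap replaced by a nonempty block of larger letters, so
  \<open>contrib_refill\<close> applies.\<close>

lemma total_fill:
  assumes "Suc i < N" "1 \<le> i" "A @ N # B \<in> gapped N i"
  shows "total (Suc i) (fill N (Suc i) A B l r) =
    total i (A @ N # B) + contrib (Suc i) (fill N (Suc i) A B l r)"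
proof -
  have "contrib v (fill N (Suc i) A B l r) = contrib v (A @ N # B)" if "v \<in> {2..i}" for v
  proof -
    have eq: "set A \<union> set B \<union> {N} = insert N {1..i}"
      using assms by (intro gapped_split(5))
    have "v \<in> set A \<union> set B \<union> {N}" "1 \<in> set A \<union> set B \<union> {N}"
      unfolding eq using that by auto
    then have "v \<in> set (A @ B)" "1 \<in> set (A @ B)"
      using that assms(1) by auto
    then show ?thesis
      using contrib_refill[of "gap N l @ Suc i # gap N r" "[N]" v A B] that assms(1)
      by (auto simp: fill_def set_gap)
  qed
  then show ?thesis
    using assms(2) by (simp add: total_def)
qed

text \<open>Moving one value from the m still to come to the i inserted ones leaves the sum
  unchanged, so everything reduces to i = 1.\<close>

lemma sum_gapped_state_sum:
  assumes "1 \<le> i" "i < N"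
  shows "(\<Sum>w\<in>gapped N i. q ^ total i w * state_sum q N m i w) = qfact (m + i) q"
  using assms
proof (induction i arbitrary: m rule: nat_induct_at_least)
  case base
  then have N: "Suc 0 < N" by simp
  \<comment> \<open>The virtual gap must survive in front of 1, so just two words arise, with the
    run of 1 open or closed.\<close>
  have eq: "(\<Sum>w\<in>gapped N 1. q ^ total 1 w * state_sum q N m 1 w) =
     state_sum q N m 1 [N, 1, N] + state_sum q N m 1 [N, 1]"
    unfolding One_nat_def
    by (subst sum_gapped_Suc[OF N])
      (use N in \<open>auto simp: gapped_0 splits_Cons sum_gap_choices fill_def total_def\<close>)
  have "before 1 [N, 1, N] = [N]" "before 1 [N, 1] = [N]" "after 1 [N, 1, N] = [N]" "after 1 [N, 1] = []"
    using N by (simp_all add: before_def after_def)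
  moreover have "\<not> marked (Suc 1) [N, 1, N]"
    unfolding marked_def special_def calculation using N by auto
  ultimately have "state_sum q N m 1 [N, 1, N] = open_sum q m 0 0"
    "state_sum q N m 1 [N, 1] = closed_sum q m 0 0"
    using N by (auto simp: state_sum_def end1_def)
  then show ?case
    using eq closed_plus_open_sum[of q m 0 0] laguerre_sum_0[of q m] by (simp add: add.commute)
next
  case (Suc i)
  have "(\<Sum>w\<in>gapped N (Suc i). q ^ total (Suc i) w * state_sum q N m (Suc i) w) =
      (\<Sum>w\<in>gapped N i. \<Sum>(A, B)\<in>splits N w. \<Sum>(l, r)\<in>gap_choices A.
         q ^ total (Suc i) (fill N (Suc i) A B l r) * state_sum q N m (Suc i) (fill N (Suc i) A B l r))"
    using Suc finite_gapped by (intro sum_gapped_Suc) auto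
  also have "\<dots> = (\<Sum>w\<in>gapped N i. q ^ total i w * state_sum q N (Suc m) i w)"
  proof (intro sum.cong refl)
    fix w assume w: "w \<in> gapped N i"
    have "(\<Sum>(A, B)\<in>splits N w. \<Sum>(l, r)\<in>gap_choices A.
         q ^ total (Suc i) (fill N (Suc i) A B l r) * state_sum q N m (Suc i) (fill N (Suc i) A B l r)) =
      (\<Sum>(A, B)\<in>splits N w. \<Sum>(l, r)\<in>gap_choices A. q ^ total i w *
         (q ^ contrib (Suc i) (fill N (Suc i) A B l r) * state_sum q N m (Suc i) (fill N (Suc i) A B l r)))"
    proof (intro sum.cong refl, clarify, intro sum.cong refl, clarify)
      fix A B l r assume "(A, B) \<in> splits N w"
      then have "w = A @ N # B" by (simp add: splits_def)
      then show "q ^ total (Suc i) (fill N (Suc i) A B l r) * state_sum q N m (Suc i) (fill N (Suc i) A B l r)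
        = q ^ total i w * (q ^ contrib (Suc i) (fill N (Suc i) A B l r)
          * state_sum q N m (Suc i) (fill N (Suc i) A B l r))"
        using total_fill[of i N A B l r] w Suc by (simp add: power_add mult.assoc)
    qed
    also have "\<dots> = q ^ total i w * state_sum q N (Suc m) i w"
      using sum_fill_state[OF _ _ w, of q m] Suc
      by (simp add: sum_distrib_left[symmetric] case_prod_unfold)
    finally show "(\<Sum>(A, B)\<in>splits N w. \<Sum>(l, r)\<in>gap_choices A.
         q ^ total (Suc i) (fill N (Suc i) A B l r) * state_sum q N m (Suc i) (fill N (Suc i) A B l r)) =
      q ^ total i w * state_sum q N (Suc m) i w" .
  qed
  also have "\<dots> = qfact (m + Suc i) q"
    using Suc by simp
  finally show ?case .
qed

lemma sum_permutations_total:
  assumes "1 \<le> n"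
  shows "(\<Sum>s\<in>permutations_of_set {1..n}. q ^ total n (Suc n # s)) = qfact n q"
proof -
  define N where "N = Suc n"
  have sub: "(#) N ` permutations_of_set {1..n} \<subseteq> gapped N n"
  proof (intro image_subsetI)
    fix s assume "s \<in> permutations_of_set {1..n}"
    then have s: "set s = {1..n}" "distinct s"
      by (auto simp: permutations_of_set_def)
    then have "N \<notin> set s" by (auto simp: N_def)
    then have "filter (\<lambda>u. u \<noteq> N) s = s" "successively (\<lambda>a b. a \<noteq> N \<or> b \<noteq> N) s"
      by (auto simp: filter_id_conv successively_conv_nth)
    then show "N # s \<in> gapped N n"
      using s \<open>N \<notin> set s\<close> by (cases s) (auto simp: gapped_def)
  qed
  \<comment> \<open>With m = 0 the weight selects the words whose only gap is the virtual one, that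
    is, the permutations.\<close>
  have st: "state_sum q N 0 n w = (if w \<in> (#) N ` permutations_of_set {1..n} then 1 else 0)"
    if w: "w \<in> gapped N n" for w
  proof -
    have "w \<noteq> []" "hd w = N" and d: "distinct (filter (\<lambda>u. u \<noteq> N) w)" and S: "set w = insert N {1..n}"
      using w by (auto simp: gapped_def)
    then obtain s where ws: "w = N # s"
      by (cases w) auto
    have "1 \<in> set w" unfolding S using assms by simp
    then have "1 \<in> set s" using assms ws N_def by simp
    then obtain P Q where s: "s = P @ 1 # Q" "1 \<notin> set P"
      by (meson split_list_first)
    have n1: "1 \<notin> set (N # P)"
      using s N_def assms by auto
    have bef: "before 1 w = N # P" and aft: "after 1 w = Q"
      using before_append_Cons[OF n1] after_append_Cons[OF n1] ws s by simp_all
    show ?thesis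
    proof (cases "N \<in> set s")
      case True
      have "w \<notin> (#) N ` permutations_of_set {1..n}"
        using True ws by (auto simp: permutations_of_set_def N_def)
      moreover have "count_list P N \<noteq> 0 \<or> count_list Q N \<noteq> 0"
        using True s N_def assms by (auto simp: count_list_0_iff)
      ultimately show ?thesis
        unfolding state_sum_def bef aft by (auto simp: Let_def)
    next
      case False
      have "set s = insert N {1..n} - {N}"
        unfolding S[symmetric] using ws False by simp
      then have "set s = {1..n}"
        by (auto simp: N_def)
      moreover have "distinct s"
        using d ws False by (metis (mono_tags, lifting) filter.simps(2) filter_True)
      ultimately have "w \<in> (#) N ` permutations_of_set {1..n}"
        using ws by (auto simp: permutations_of_set_def)
      moreover have "end1 w \<in> insert 1 (set Q)"
        unfolding end1_def aft by (rule run_end_mem)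
      then have "end1 w \<le> n"
        using \<open>set s = {1..n}\<close> s assms by auto
      moreover have "count_list P N = 0" "count_list Q N = 0"
        using False s by (auto simp: count_list_0_iff)
      ultimately show ?thesis
        unfolding state_sum_def bef aft by simp
    qed
  qed
  have "(\<Sum>w\<in>gapped N n. q ^ total n w * state_sum q N 0 n w) =
      (\<Sum>w\<in>gapped N n. if w \<in> (#) N ` permutations_of_set {1..n} then q ^ total n w else 0)"
    by (intro sum.cong) (simp_all add: st)
  also have "\<dots> = (\<Sum>w\<in>(#) N ` permutations_of_set {1..n}. q ^ total n w)"
    using sub finite_gapped[of n N] by (simp add: N_def sum.inter_restrict[symmetric] Int_absorb1)
  also have "\<dots> = (\<Sum>s\<in>permutations_of_set {1..n}. q ^ total n (N # s))"
    by (simp add: sum.reindex)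
  finally show ?thesis
    using sum_gapped_state_sum[of n N q 0] assms by (simp add: N_def)
qed

section \<open>Runs of a permutation\<close>

lemma desc_before_Suc: "desc_before s (Suc i) = desc_before s i + of_bool (s ! i > s ! Suc i)"
proof -
  have fin: "finite {j. j + 1 \<le> i \<and> s ! j > s ! (j + 1)}"
    by (rule finite_subset[of _ "{..i}"]) auto
  have "{j. j + 1 \<le> Suc i \<and> s ! j > s ! (j + 1)} =
      (if s ! i > s ! Suc i then insert i {j. j + 1 \<le> i \<and> s ! j > s ! (j + 1)}
       else {j. j + 1 \<le> i \<and> s ! j > s ! (j + 1)})"
    by (auto simp: le_Suc_eq)
  then show ?thesis using fin by (simp add: desc_before_def)
qed

lemma desc_before_mono: "i \<le> j \<Longrightarrow> desc_before s i \<le> desc_before s j"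
  by (rule lift_Suc_mono_le[of "desc_before s"]) (simp_all add: desc_before_Suc)

lemma cross_eq_card: "cross v xs = card {j. Suc j < length xs \<and> xs ! j < v \<and> v < xs ! Suc j}"
proof (induction v xs rule: cross.induct)
  case (1 v a b xs)
  let ?J = "{j. Suc j < length (b # xs) \<and> (b # xs) ! j < v \<and> v < (b # xs) ! Suc j}"
  have "{j. Suc j < length (a # b # xs) \<and> (a # b # xs) ! j < v \<and> v < (a # b # xs) ! Suc j} =
      (if a < v \<and> v < b then {0} else {}) \<union> Suc ` ?J"
  proof (intro set_eqI)
    fix j show "j \<in> {j. Suc j < length (a # b # xs) \<and> (a # b # xs) ! j < v \<and> v < (a # b # xs) ! Suc j}
      \<longleftrightarrow> j \<in> (if a < v \<and> v < b then {0} else {}) \<union> Suc ` ?J"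
      by (cases j) auto
  qed
  moreover have "finite ?J"
    by (rule finite_subset[of _ "{..length xs}"]) auto
  ultimately show ?case
    using 1 by (simp add: card_image card_insert_if)
qed auto

lemma lrmin_singleton_iff:
  "lrmin_singleton c Q \<longleftrightarrow>
     (\<exists>k<length Q. Q ! k = c \<and> (\<forall>j<k. c < Q ! j) \<and> (Suc k = length Q \<or> Q ! Suc k < c))"
proof (induction Q)
  case (Cons b Q)
  have "(\<exists>k<length (b # Q). (b # Q) ! k = c \<and> (\<forall>j<k. c < (b # Q) ! j)
        \<and> (Suc k = length (b # Q) \<or> (b # Q) ! Suc k < c)) \<longleftrightarrow>
      (b = c \<and> (Q = [] \<or> hd Q < c)) \<or> c < b \<and> (\<exists>k<length Q. Q ! k = c \<and> (\<forall>j<k. c < Q ! j)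
        \<and> (Suc k = length Q \<or> Q ! Suc k < c))"
    by (cases "Q = []") (auto simp: Ex_less_Suc2 All_less_Suc2 hd_conv_nth)
  then show ?case using Cons by auto
qed simp

text \<open>Once the run exceeds c, its remaining letters do so too and are skipped by
  \<open>lrmin_singleton\<close>; the place of the switch has no influence.\<close>

lemma lrmin_singleton_past_sorted:
  assumes "sorted (a # R)" "a \<le> c" "Q = [] \<or> hd Q < last (a # R)"
  shows "lrmin_singleton_past c a (R @ Q) \<longleftrightarrow> c < last (a # R) \<and> lrmin_singleton c Q"
  using assms
proof (induction R arbitrary: a)
  case Nil
  then show ?case by (cases Q) auto
next
  case (Cons b R)
  show ?case
  proof (cases "c < b")
    case True
    then have R: "\<forall>y\<in>set (b # R). c < y"
      using Cons.prems by fastforce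
    then have "c < last (b # R)" "\<forall>y\<in>set R. c < y"
      using last_in_set[of "b # R"] by (blast, simp)
    then show ?thesis
      using True Cons.prems by (auto simp: lrmin_singleton_append_greater)
  next
    case False
    then show ?thesis using Cons by auto
  qed
qed

section \<open>Runs of a word with distinct letters, in terms of positions\<close>

locale perm_word =
  fixes s :: "nat list"
  assumes dist: "distinct s"
begin

lemma run_of_self: "p < length s \<Longrightarrow> p \<in> run_of s p"
  by (simp add: run_of_def)

lemma finite_run_of [simp]: "finite (run_of s p)"
  by (rule finite_subset[of _ "{..<length s}"]) (auto simp: run_of_def)

lemma run_of_lt: "a \<in> run_of s p \<Longrightarrow> a < length s"
  by (simp add: run_of_def)

lemma run_of_eq: "a \<in> run_of s p \<Longrightarrow> run_of s a = run_of s p"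
  by (simp add: run_of_def)

lemma run_of_convex:
  assumes "a \<in> run_of s p" "b \<in> run_of s p" "a \<le> c" "c \<le> b"
  shows "c \<in> run_of s p"
  using assms desc_before_mono[of a c s] desc_before_mono[of c b s] by (auto simp: run_of_def)

lemma Suc_in_run_of: "Suc p < length s \<Longrightarrow> Suc p \<in> run_of s p \<longleftrightarrow> s ! p < s ! Suc p"
  using dist nth_eq_iff_index_eq[of s p "Suc p"] by (auto simp: run_of_def desc_before_Suc)

lemma run_of_increasing:
  assumes "a \<in> run_of s p" "b \<in> run_of s p" "a < b"
  shows "s ! a < s ! b"
proof -
  have "b' \<le> b \<Longrightarrow> s ! a < s ! b'" if "Suc a \<le> b'" for b'
    using that
  proof (induction b' rule: dec_induct)
    case base
    then have "Suc a \<in> run_of s p"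
      using run_of_convex[OF assms(1,2)] by simp
    then show ?case
      using Suc_in_run_of[of a] run_of_lt run_of_eq[OF assms(1)] by blast
  next
    case (step k)
    then have "k \<in> run_of s p" "Suc k \<in> run_of s p"
      using run_of_convex[OF assms(1,2)] by simp_all
    then have "s ! k < s ! Suc k"
      using Suc_in_run_of[of k] run_of_lt run_of_eq by blast
    then show ?case using step by simp
  qed
  then show ?thesis using assms(3) by simp
qed

lemma run_of_nth_le:
  assumes "a \<in> run_of s p" "b \<in> run_of s p" "a \<le> b"
  shows "s ! a \<le> s ! b"
  using run_of_increasing[OF assms(1,2)] assms(3) by (cases "a = b") auto

abbreviation rise :: "nat \<Rightarrow> bool" where
  "rise p \<equiv> Suc p < length s \<and> s ! p < s ! Suc p"

lemma rise_iff: "p < length s \<Longrightarrow> rise p \<longleftrightarrow> (\<exists>a\<in>run_of s p. p < a)"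
proof
  assume "p < length s" "\<exists>a\<in>run_of s p. p < a"
  then have "Suc p \<in> run_of s p"
    using run_of_convex[of p p _ "Suc p"] run_of_self by auto
  then show "rise p" using Suc_in_run_of run_of_lt by blast
qed (use Suc_in_run_of in blast)

lemma start_iff: "p < length s \<Longrightarrow> (p = 0 \<or> s ! p < s ! (p - 1)) \<longleftrightarrow> \<not> (\<exists>a\<in>run_of s p. a < p)"
proof (cases p)
  case (Suc k)
  assume p: "p < length s"
  have "(\<exists>a\<in>run_of s p. a < p) \<longleftrightarrow> k \<in> run_of s p"
    using run_of_convex[of _ p p k] run_of_self[OF p] Suc by auto
  also have "\<dots> \<longleftrightarrow> p \<in> run_of s k"
    using p Suc by (auto simp: run_of_def)
  also have "\<dots> \<longleftrightarrow> s ! k < s ! p"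
    using Suc_in_run_of[of k] p Suc by simp
  also have "\<dots> \<longleftrightarrow> \<not> s ! p < s ! k"
    using dist nth_eq_iff_index_eq[of s p k] p Suc by auto
  finally show ?thesis using Suc by simp
qed simp

lemma closer_or_singleton_iff:
  assumes "p < length s"
  shows "is_closer s p \<or> is_singleton s p \<longleftrightarrow> \<not> rise p"
proof -
  have c1: "1 \<le> card (run_of s p)"
    using run_of_self[OF assms] by (simp add: Suc_le_eq card_gt_0_iff) blast
  have M: "p = Max (run_of s p) \<longleftrightarrow> \<not> rise p"
    unfolding rise_iff[OF assms] using run_of_self[OF assms] Max_ge[of "run_of s p"]
    by (metis Max_in empty_iff finite_run_of leD le_neq_implies_less)
  have "p = Max (run_of s p)" if "card (run_of s p) = 1"
  proof -
    have "run_of s p = {p}"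
      using that run_of_self[OF assms] by (metis card_1_singletonE singletonD)
    then show ?thesis by simp
  qed
  then show ?thesis
    unfolding is_closer_def is_singleton_def M[symmetric] using c1 by (auto simp: le_Suc_eq)
qed

lemma is_singleton_iff:
  assumes "p < length s"
  shows "is_singleton s p \<longleftrightarrow> (p = 0 \<or> s ! p < s ! (p - 1)) \<and> \<not> rise p"
proof -
  have "is_singleton s p \<longleftrightarrow> run_of s p = {p}"
    unfolding is_singleton_def using run_of_self[OF assms]
    by (metis card_1_singletonE is_singletonI is_singleton_altdef singletonD)
  also have "\<dots> \<longleftrightarrow> \<not> (\<exists>a\<in>run_of s p. a < p) \<and> \<not> (\<exists>a\<in>run_of s p. p < a)"
    using run_of_self[OF assms] by (auto intro: linorder_neqE_nat)
  finally show ?thesis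
    unfolding start_iff[OF assms] rise_iff[OF assms] .
qed

text \<open>Each run is represented by its first position.\<close>

lemma nruns_eq: "nruns s = card {p. p < length s \<and> (p = 0 \<or> s ! p < s ! (p - 1))}"
proof -
  let ?P = "{p. p < length s \<and> (p = 0 \<or> s ! p < s ! (p - 1))}"
  have "bij_betw (run_of s) ?P (runs s)"
  proof (intro bij_betw_imageI)
    show "inj_on (run_of s) ?P"
    proof (intro inj_onI)
      fix p p' assume p: "p \<in> ?P" "p' \<in> ?P" "run_of s p = run_of s p'"
      then have "p \<in> run_of s p'" "p' \<in> run_of s p"
        using run_of_self by auto
      then show "p = p'"
        using start_iff[of p] start_iff[of p'] p by (metis (mono_tags, lifting) linorder_neqE_nat mem_Collect_eq)
    qed
    show "run_of s ` ?P = runs s"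
    proof (intro equalityI subsetI)
      fix R assume "R \<in> runs s"
      then obtain a where a: "a < length s" "R = run_of s a"
        by (auto simp: runs_def)
      define p where "p = Min R"
      have "p \<in> R"
        unfolding p_def using a run_of_self[OF a(1)] by (intro Min_in) auto
      then have "run_of s p = R" "p < length s"
        using a run_of_eq run_of_lt by auto
      moreover have "\<not> (\<exists>a\<in>R. a < p)"
        unfolding p_def using Min_le[of R] a by (auto simp: not_less)
      ultimately have "p \<in> ?P" using start_iff[of p] by simp
      then show "R \<in> run_of s ` ?P"
        using \<open>run_of s p = R\<close> by blast
    qed (auto simp: runs_def)
  qed
  then show ?thesis
    by (simp add: nruns_def bij_betw_same_card)
qed

text \<open>A run is increasing, so if it straddles \<open>s ! p\<close> without containing p it
  passes that value in exactly one ascent. It is an interval of positions, so it lies wholly on the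
  side of p where this ascent lies.\<close>

lemma bij_betw_crossing:
  assumes p: "p < length s" and side: "side = (<) \<or> side = (>)"
  shows "bij_betw (run_of s) {j. Suc j < length s \<and> s ! j < s ! p \<and> s ! p < s ! Suc j \<and> side j p}
    {R \<in> runs s. R \<noteq> run_of s p \<and> (\<forall>a\<in>R. side a p) \<and> straddles s R (s ! p)}"
    (is "bij_betw _ ?J ?S")
proof (intro bij_betw_imageI)
  show "inj_on (run_of s) ?J"
  proof (intro inj_onI)
    have *: False if j: "j \<in> ?J" "k \<in> ?J" "run_of s j = run_of s k" "j < k" for j k
    proof -
      have "Suc j \<in> run_of s j" "k \<in> run_of s j"
        using j Suc_in_run_of[of j] run_of_self[of k] by auto
      then have "s ! Suc j \<le> s ! k"
        using run_of_nth_le[of "Suc j" j k] j(4) by simp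
      then show False using j by auto
    qed
    fix j k assume "j \<in> ?J" "k \<in> ?J" "run_of s j = run_of s k"
    then show "j = k" using *[of j k] *[of k j] by (metis linorder_neqE_nat)
  qed
  show "run_of s ` ?J = ?S"
  proof (intro equalityI subsetI)
    fix R assume "R \<in> run_of s ` ?J"
    then obtain j where j: "j \<in> ?J" and R: "R = run_of s j" by blast
    have in_R: "j \<in> R" "Suc j \<in> R"
      unfolding R using j Suc_in_run_of[of j] run_of_self[of j] by auto
    have pR: "p \<notin> R"
    proof
      assume "p \<in> R"
      then consider "p < j" | "p = j" | "p = Suc j" | "Suc j < p"
        by linarith
      then show False
        using run_of_increasing[of p j j] run_of_increasing[of "Suc j" j p] \<open>p \<in> R\<close> in_R j
        unfolding R by cases auto
    qed
    have "side a p" if a: "a \<in> R" for a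
    proof (rule ccontr)
      assume "\<not> side a p"
      then have "a \<le> p \<and> p \<le> j \<or> j \<le> p \<and> p \<le> a"
        using side j by auto
      then have "p \<in> R"
        using run_of_convex[of _ j _ p] a in_R(1) unfolding R by blast
      then show False using pR by contradiction
    qed
    moreover have "R \<noteq> run_of s p"
      using pR run_of_self[OF p] by blast
    moreover have "R \<in> runs s" unfolding R runs_def using j by auto
    moreover have "straddles s R (s ! p)"
      unfolding straddles_def using in_R j by auto
    ultimately show "R \<in> ?S" by blast
  next
    fix R assume R: "R \<in> ?S"
    then obtain a0 where a0: "a0 < length s" "R = run_of s a0"
      by (auto simp: runs_def)
    have pR: "p \<notin> R" using R side by auto
    \<comment> \<open>The last position of the run with a value below \<open>s ! p\<close>; the
      ascent starts here.\<close>
    define j where "j = Max {a \<in> R. s ! a < s ! p}"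
    have fin: "finite {a \<in> R. s ! a < s ! p}" using a0 by simp
    moreover have "{a \<in> R. s ! a < s ! p} \<noteq> {}" using R by (auto simp: straddles_def)
    ultimately have "j \<in> {a \<in> R. s ! a < s ! p}" unfolding j_def by (rule Max_in)
    then have j: "j \<in> R" "s ! j < s ! p" by auto
    obtain b where b: "b \<in> R" "s ! p < s ! b" using R by (auto simp: straddles_def)
    have "j < b"
    proof (rule ccontr)
      assume "\<not> j < b"
      then have "s ! b \<le> s ! j" using run_of_nth_le[of b a0 j] b j a0 by simp
      then show False using b j by simp
    qed
    then have Sj: "Suc j \<in> R"
      using run_of_convex[of j a0 b "Suc j"] j b a0 by simp
    have "\<not> s ! Suc j < s ! p"
    proof
      assume "s ! Suc j < s ! p"
      then have "Suc j \<le> Max {a \<in> R. s ! a < s ! p}" using Sj fin by (intro Max_ge) auto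
      then have "Suc j \<le> j" by (simp only: j_def)
      then show False by simp
    qed
    moreover have "Suc j < length s" using Sj a0 run_of_lt by auto
    moreover have "s ! Suc j \<noteq> s ! p"
      using dist calculation(2) p Sj pR nth_eq_iff_index_eq[of s "Suc j" p] by metis
    ultimately have "j \<in> ?J"
      using j R by auto
    moreover have "run_of s j = R" using j a0 run_of_eq by simp
    ultimately show "R \<in> run_of s ` ?J" by blast
  qed
qed

end

section \<open>The statistic as a sum of contributions\<close>

locale std_perm = perm_word s for s +
  fixes n :: nat
  assumes set_s: "set s = {1..n}" and n: "1 \<le> n"
begin

abbreviation w where "w \<equiv> Suc n # s"

lemma nth_range: "p < length s \<Longrightarrow> 1 \<le> s ! p \<and> s ! p \<le> n"
  using set_s nth_mem by fastforce

lemma bij_nth: "bij_betw ((!) s) {..<length s} {1..n}"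
  using bij_betw_nth[OF dist refl refl] set_s by simp

lemma before_nth: "p < length s \<Longrightarrow> before (s ! p) w = Suc n # take p s"
  and after_nth: "p < length s \<Longrightarrow> after (s ! p) w = drop (Suc p) s"
proof -
  assume p: "p < length s"
  have "s ! p \<notin> set (take p s)"
    using dist p by (metis distinct_take id_take_nth_drop not_distinct_conv_prefix take_Suc_conv_app_nth)
  then have 1: "s ! p \<notin> set (Suc n # take p s)"
    using nth_range[OF p] by auto
  have w: "w = (Suc n # take p s) @ s ! p # drop (Suc p) s"
    using id_take_nth_drop[OF p] by simp
  show "before (s ! p) w = Suc n # take p s" "after (s ! p) w = drop (Suc p) s"
    by (simp_all only: w before_append_Cons[OF 1] after_append_Cons[OF 1])
qed

lemma pos_nth: "p < length s \<Longrightarrow> pos s (s ! p) = p"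
  unfolding pos_def using dist by (intro the_equality) (auto simp: nth_eq_iff_index_eq)

definition p1 where "p1 = pos s 1"

lemma p1: "p1 < length s" "s ! p1 = 1"
proof -
  have "1 \<in> set s" using set_s n by simp
  then obtain p where "p < length s" "s ! p = 1" by (metis in_set_conv_nth)
  then have "p1 = p" using pos_nth p1_def by metis
  then show "p1 < length s" "s ! p1 = 1" using \<open>p < length s\<close> \<open>s ! p = 1\<close> by simp_all
qed

lemma R1_eq: "R1 s = run_of s p1"
  by (simp add: R1_def p1_def)

text \<open>\<open>s ! e\<close> is the value d in the definition of \<open>nu\<close>.\<close>

definition e where "e = Max (run_of s p1)"

lemma e_in: "e \<in> run_of s p1"
  unfolding e_def using run_of_self[OF p1(1)] by (intro Max_in) auto

lemma e_ge: "a \<in> run_of s p1 \<Longrightarrow> a \<le> e"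
  unfolding e_def by simp

lemma e_lt: "e < length s"
  using e_in run_of_lt by blast

lemma p1_le_e: "p1 \<le> e"
  using e_ge run_of_self[OF p1(1)] by blast

lemma not_rise_e: "\<not> rise e"
  using rise_iff[OF e_lt] run_of_eq[OF e_in] e_ge by (auto simp: not_less)

lemma dval_eq: "dval s = s ! e"
  unfolding dval_def R1_eq
proof (rule Max_eqI)
  fix y assume "y \<in> (!) s ` run_of s p1"
  then show "y \<le> s ! e" using run_of_nth_le e_in e_ge by auto
qed (use e_in in auto)

lemma drop_e: "drop (Suc e) s = [] \<or> hd (drop (Suc e) s) < s ! e"
proof (cases "Suc e < length s")
  case True
  have "s ! Suc e \<noteq> s ! e" using dist True e_lt by (simp add: nth_eq_iff_index_eq)
  then show ?thesis using True not_rise_e by (auto simp: hd_drop_conv_nth)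
qed simp

lemma after_1: "after 1 w = drop (Suc p1) (take (Suc e) s) @ drop (Suc e) s" (is "_ = ?R @ _")
  and sorted_1: "sorted (1 # drop (Suc p1) (take (Suc e) s))"
  and last_1: "last (1 # drop (Suc p1) (take (Suc e) s)) = s ! e"
proof -
  have "drop (Suc p1) s = drop (Suc p1) (take (Suc e) s @ drop (Suc e) s)"
    by simp
  also have "\<dots> = ?R @ drop (Suc e) s"
    using p1_le_e e_lt by (subst drop_append) simp
  finally show "after 1 w = ?R @ drop (Suc e) s"
    using after_nth[OF p1(1)] p1 by simp
  have C: "1 # ?R = drop p1 (take (Suc e) s)"
    using Cons_nth_drop_Suc[of p1 "take (Suc e) s"] p1_le_e p1 e_lt by simp
  have in_run: "p1 + k \<in> run_of s p1" if "k < length (drop p1 (take (Suc e) s))" for k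
    using that e_lt by (intro run_of_convex[OF run_of_self[OF p1(1)] e_in]) auto
  show "sorted (1 # ?R)"
    unfolding C sorted_iff_nth_mono
  proof (intro allI impI)
    fix i j assume ij: "i \<le> j" "j < length (drop p1 (take (Suc e) s))"
    then have "s ! (p1 + i) \<le> s ! (p1 + j)"
      using run_of_nth_le[OF in_run[of i] in_run[of j]] by simp
    moreover have "p1 + i \<le> e" "p1 + j \<le> e"
      using ij by auto
    ultimately show "drop p1 (take (Suc e) s) ! i \<le> drop p1 (take (Suc e) s) ! j"
      using p1_le_e e_lt by simp
  qed
  show "last (1 # ?R) = s ! e"
    unfolding C using p1_le_e e_lt by (simp add: last_drop last_conv_nth)
qed

lemma end1_eq: "end1 w = s ! e"
  unfolding end1_def after_1 run_end_append_sorted[OF sorted_1] last_1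
  using drop_e by (cases "drop (Suc e) s") auto

lemma special_iff:
  assumes "1 \<le> c"
  shows "special c w \<longleftrightarrow> c < s ! e \<and> lrmin_singleton c (drop (Suc e) s)"
  unfolding special_def after_1
  using lrmin_singleton_past_sorted[OF sorted_1 assms, of "drop (Suc e) s"] drop_e
  unfolding last_1 by blast

lemma rises_nth: "p < length s \<Longrightarrow> rises (s ! p) w \<longleftrightarrow> rise p"
  by (auto simp: rises_def after_nth hd_drop_conv_nth)

lemma mem_take_1: "1 \<in> set (Suc n # take p s) \<longleftrightarrow> p1 < p"
proof -
  have "1 \<in> set (Suc n # take p s) \<longleftrightarrow> (\<exists>k<length (take p s). s ! k = 1)"
    using n by (auto simp: in_set_conv_nth)
  also have "\<dots> \<longleftrightarrow> p1 < p"
    using p1 dist by (auto simp: nth_eq_iff_index_eq) (metis nth_eq_iff_index_eq)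
  finally show ?thesis .
qed

lemma mem_drop_1: "p < length s \<Longrightarrow> 1 \<in> set (drop (Suc p) s) \<longleftrightarrow> p < p1"
proof -
  assume p: "p < length s"
  have "1 \<in> set (drop (Suc p) s) \<longleftrightarrow> (\<exists>k<length s - Suc p. s ! (Suc p + k) = 1)"
    by (auto simp: in_set_conv_nth)
  also have "\<dots> \<longleftrightarrow> p < p1"
  proof
    assume "\<exists>k<length s - Suc p. s ! (Suc p + k) = 1"
    then obtain k where "k < length s - Suc p" "s ! (Suc p + k) = s ! p1" using p1 by auto
    then have "Suc p + k < length s" "s ! (Suc p + k) = s ! p1" by simp_all
    then have "Suc p + k = p1" using dist p1 nth_eq_iff_index_eq by blast
    then show "p < p1" by simp
  next
    assume "p < p1"
    then show "\<exists>k<length s - Suc p. s ! (Suc p + k) = 1"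
      using p1 by (intro exI[of _ "p1 - Suc p"]) auto
  qed
  finally show ?thesis .
qed

lemma cross_left: "p < length s \<Longrightarrow>
  cross (s ! p) (Suc n # take p s) =
    card {R \<in> runs s. R \<noteq> run_of s p \<and> (\<forall>a\<in>R. a < p) \<and> straddles s R (s ! p)}"
proof -
  assume p: "p < length s"
  have "cross (s ! p) (Suc n # take p s) = cross (s ! p) (take p s)"
    using nth_range[OF p] by (intro cross_Cons_ge) simp
  also have "\<dots> = card {j. Suc j < length s \<and> s ! j < s ! p \<and> s ! p < s ! Suc j \<and> j < p}"
    unfolding cross_eq_card
  proof (intro arg_cong[where f = card] Collect_cong)
    fix j
    show "Suc j < length (take p s) \<and> take p s ! j < s ! p \<and> s ! p < take p s ! Suc j \<longleftrightarrow>
        Suc j < length s \<and> s ! j < s ! p \<and> s ! p < s ! Suc j \<and> j < p"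
      using p by (cases "Suc j = p") auto
  qed
  also have "\<dots> = card {R \<in> runs s. R \<noteq> run_of s p \<and> (\<forall>a\<in>R. a < p) \<and> straddles s R (s ! p)}"
    using bij_betw_same_card[OF bij_betw_crossing[OF p, of "(<)"]] by simp
  finally show ?thesis .
qed

lemma cross_right: "p < length s \<Longrightarrow>
  cross (s ! p) (drop (Suc p) s) =
    card {R \<in> runs s. R \<noteq> run_of s p \<and> (\<forall>a\<in>R. a > p) \<and> straddles s R (s ! p)}"
proof -
  assume p: "p < length s"
  let ?J = "{j. Suc j < length (drop (Suc p) s) \<and> drop (Suc p) s ! j < s ! p \<and> s ! p < drop (Suc p) s ! Suc j}"
  let ?K = "{j. Suc j < length s \<and> s ! j < s ! p \<and> s ! p < s ! Suc j \<and> j > p}"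
  have "bij_betw ((+) (Suc p)) ?J ?K"
  proof (intro bij_betw_imageI)
    show "(+) (Suc p) ` ?J = ?K"
    proof (intro equalityI subsetI)
      fix j assume j: "j \<in> ?K"
      then obtain k where "j = Suc p + k"
        by (metis (mono_tags, lifting) Suc_leI le_Suc_ex mem_Collect_eq)
      then show "j \<in> (+) (Suc p) ` ?J"
        using j by (intro image_eqI[of _ _ k]) auto
    qed auto
  qed auto
  then have "cross (s ! p) (drop (Suc p) s) = card ?K"
    unfolding cross_eq_card by (rule bij_betw_same_card)
  also have "\<dots> = card {R \<in> runs s. R \<noteq> run_of s p \<and> (\<forall>a\<in>R. a > p) \<and> straddles s R (s ! p)}"
    using bij_betw_same_card[OF bij_betw_crossing[OF p, of "(>)"]] by simp
  finally show ?thesis .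
qed

text \<open>On its side of p the run of 1 straddles \<open>s ! p\<close> precisely when
  \<open>s ! p < s ! e\<close>, so it is removed or added according to this comparison. If p itself
  lies in that run, a rise at p is equivalent to \<open>s ! p < s ! e\<close>, and both corrections
  vanish.\<close>

lemma side_sets:
  assumes p: "p < length s" and side: "side = (<) \<or> side = (>)"
  defines "S \<equiv> {R \<in> runs s. R \<noteq> run_of s p \<and> (\<forall>a\<in>R. side a p) \<and> straddles s R (s ! p)}"
  shows "\<not> rise p \<Longrightarrow> card {R \<in> runs s. R \<noteq> run_of s p \<and> (\<forall>a\<in>R. side a p) \<and> R \<noteq> R1 s \<and> straddles s R (s ! p)}
      = card S - of_bool (side p1 p \<and> s ! p < s ! e)" (is "_ \<Longrightarrow> ?thesis1")
    and "rise p \<Longrightarrow> card {R \<in> runs s. R \<noteq> run_of s p \<and> (\<forall>a\<in>R. side a p) \<and> (R = R1 s \<or> straddles s R (s ! p))}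
      = card S + of_bool (side p1 p \<and> \<not> s ! p < s ! e)" (is "_ \<Longrightarrow> ?thesis2")
proof -
  have finS: "finite S"
    by (rule finite_subset[of _ "runs s"]) (auto simp: S_def runs_def)
  have R1_runs: "R1 s \<in> runs s"
    using p1 by (auto simp: R1_eq runs_def)
  have R1_neq: "R1 s \<noteq> run_of s p" if "p \<notin> R1 s"
    using that run_of_self[OF p] by blast
  have R1_side: "\<forall>a\<in>R1 s. side a p" if "p \<notin> R1 s" "side p1 p"
  proof (intro ballI, rule ccontr)
    fix a assume a: "a \<in> R1 s" "\<not> side a p"
    then have "a \<le> p \<and> p \<le> p1 \<or> p1 \<le> p \<and> p \<le> a"
      using side that by auto
    then have "p \<in> R1 s"
      using run_of_convex[of _ p1 _ p] a run_of_self[OF p1(1)] unfolding R1_eq by blast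
    then show False using that(1) by contradiction
  qed
  have p1_side: "side p1 p" if "\<forall>a\<in>R1 s. side a p"
    using that run_of_self[OF p1(1)] R1_eq by blast
  have le_e: "s ! a \<le> s ! e" if "a \<in> R1 s" for a
    using that run_of_nth_le[OF _ e_in] e_ge unfolding R1_eq by blast
  have R1_straddles: "straddles s (R1 s) (s ! p) \<longleftrightarrow> s ! p < s ! e" if "side p1 p"
  proof
    assume "s ! p < s ! e"
    moreover have "s ! p \<noteq> s ! p1"
      using that side nth_eq_iff_index_eq[OF dist p p1(1)] by auto
    then have "s ! p1 < s ! p" using nth_range[OF p] p1 by simp
    ultimately show "straddles s (R1 s) (s ! p)"
      unfolding straddles_def R1_eq using e_in run_of_self[OF p1(1)] by blast
  qed (auto simp: straddles_def dest!: le_e)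
  have p_R1: "rise p \<longleftrightarrow> s ! p < s ! e" if "p \<in> R1 s"
  proof -
    have r: "run_of s p = run_of s p1" using that run_of_eq unfolding R1_eq by blast
    show ?thesis
    proof
      assume "rise p"
      then obtain a where "a \<in> run_of s p1" "p < a" using rise_iff[OF p] r by auto
      then have "p < e" using e_ge[of a] by simp
      then show "s ! p < s ! e" using run_of_increasing e_in that unfolding R1_eq by blast
    next
      assume "s ! p < s ! e"
      moreover have "p \<le> e" using e_ge that unfolding R1_eq by blast
      ultimately have "p < e" by (cases "p = e") auto
      then show "rise p" unfolding rise_iff[OF p] r using e_in by blast
    qed
  qed
  have R1_S: "R1 s \<in> S \<longleftrightarrow> p \<notin> R1 s \<and> side p1 p \<and> s ! p < s ! e"
    using R1_runs R1_neq R1_side p1_side R1_straddles run_of_eq[of p p1] run_of_self[OF p]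
    unfolding S_def R1_eq by blast
  {
    assume r: "\<not> rise p"
    have "{R \<in> runs s. R \<noteq> run_of s p \<and> (\<forall>a\<in>R. side a p) \<and> R \<noteq> R1 s \<and> straddles s R (s ! p)} = S - {R1 s}"
      by (auto simp: S_def)
    moreover have "R1 s \<in> S \<longleftrightarrow> side p1 p \<and> s ! p < s ! e"
      using R1_S p_R1 r by blast
    ultimately show ?thesis1
      using finS by (simp add: card_Diff_singleton_if)
  next
    assume r: "rise p"
    have "{R \<in> runs s. R \<noteq> run_of s p \<and> (\<forall>a\<in>R. side a p) \<and> (R = R1 s \<or> straddles s R (s ! p))} =
        (if side p1 p \<and> \<not> s ! p < s ! e then insert (R1 s) S else S)"
    proof (cases "side p1 p \<and> \<not> s ! p < s ! e")
      case True
      then have "p \<notin> R1 s" using p_R1 r by blast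
      then show ?thesis using True R1_runs R1_neq R1_side by (auto simp: S_def)
    next
      case False
      have "straddles s (R1 s) (s ! p)" if "\<forall>a\<in>R1 s. side a p"
        using p1_side[OF that] R1_straddles False by blast
      then show ?thesis using False by (auto simp: S_def)
    qed
    moreover have "R1 s \<notin> S" if "\<not> s ! p < s ! e"
      using R1_S that by blast
    ultimately show ?thesis2
      using finS by (simp add: card_insert_if)
  }
qed

lemma lsg_star_at_eq:
  assumes p: "p < length s"
  shows "lsg_star_at s p = side_count (s ! p) w (before (s ! p) w)"
  unfolding lsg_star_at_def closer_or_singleton_iff[OF p] side_count_def rises_nth[OF p]
    before_nth[OF p] mem_take_1 cross_left[OF p] end1_eq
  using side_sets[OF p, of "(<)"] by simp

lemma rsg_star_at_eq:
  assumes p: "p < length s"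
  shows "rsg_star_at s p = side_count (s ! p) w (after (s ! p) w)"
  unfolding rsg_star_at_def closer_or_singleton_iff[OF p] side_count_def rises_nth[OF p]
    after_nth[OF p] mem_drop_1[OF p] cross_right[OF p] end1_eq
  using side_sets[OF p, of "(>)"] by simp

text \<open>With \<open>Q\<close> the part behind position e, a position p corresponds to index p -
  e - 1 of \<open>Q\<close>; a left-to-right minimum lies below the first letter of
  \<open>Q\<close>, hence below d, as \<open>special\<close> demands.\<close>

lemma lrmin_singleton_set_eq:
  "{p. lrmin_w s p \<and> is_singleton s p} = {p. p < length s \<and> special (s ! p) w}"
proof (intro Collect_cong)
  fix p
  have pe: "pos s (dval s) = e" using pos_nth[OF e_lt] dval_eq by simp
  define Q where "Q = drop (Suc e) s"
  show "lrmin_w s p \<and> is_singleton s p \<longleftrightarrow> p < length s \<and> special (s ! p) w"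
  proof
    assume L: "lrmin_w s p \<and> is_singleton s p"
    then have p: "e < p" "p < length s" and min: "\<And>p'. e < p' \<Longrightarrow> p' < p \<Longrightarrow> s ! p < s ! p'"
      unfolding lrmin_w_def pe by auto
    have nr: "\<not> rise p" using L is_singleton_iff[OF p(2)] by blast
    have "s ! p \<le> s ! Suc e" using min[of "Suc e"] p by (cases "p = Suc e") auto
    also have "s ! Suc e < s ! e" using drop_e p by (auto simp: hd_drop_conv_nth)
    finally have lt: "s ! p < s ! e" .
    define k where "k = p - Suc e"
    have k: "p = Suc e + k" "k < length Q" using p by (auto simp: k_def Q_def)
    have "\<forall>j<k. s ! p < Q ! j"
      using min k p by (auto simp: Q_def)
    moreover have "Q ! k = s ! p" using k p by (simp add: Q_def)
    moreover have "Suc k = length Q \<or> Q ! Suc k < s ! p"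
    proof (cases "Suc p < length s")
      case True
      then have "s ! Suc p \<noteq> s ! p" using dist by (simp add: nth_eq_iff_index_eq)
      then have "s ! Suc p < s ! p" using True nr by auto
      then show ?thesis using k True by (simp add: Q_def)
    qed (use k p in \<open>auto simp: Q_def\<close>)
    ultimately have "lrmin_singleton (s ! p) Q"
      unfolding lrmin_singleton_iff using k by blast
    then show "p < length s \<and> special (s ! p) w"
      using special_iff[of "s ! p"] nth_range[OF p(2)] lt p Q_def by blast
  next
    assume L: "p < length s \<and> special (s ! p) w"
    then have p: "p < length s" by blast
    have "lrmin_singleton (s ! p) Q" and lt: "s ! p < s ! e"
      using L special_iff[of "s ! p"] nth_range[OF p] Q_def by blast+
    then obtain k where k: "k < length Q" "Q ! k = s ! p" "\<forall>j<k. s ! p < Q ! j"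
        "Suc k = length Q \<or> Q ! Suc k < s ! p"
      unfolding lrmin_singleton_iff by blast
    have "Suc e + k < length s" "s ! (Suc e + k) = s ! p"
      using k by (auto simp: Q_def)
    then have pk: "p = Suc e + k" using dist p nth_eq_iff_index_eq by metis
    have min: "s ! p < s ! p'" if "e < p'" "p' < p" for p'
    proof -
      have "s ! p < Q ! (p' - Suc e)" using k(3) that pk by auto
      then show ?thesis using that p by (simp add: Q_def)
    qed
    have "\<not> rise p"
      using k(4) pk by (auto simp: Q_def)
    \<comment> \<open>For k = 0 the preceding position is e itself, and \<open>lt\<close> gives the
      descent.\<close>
    moreover have "s ! p < s ! (p - 1)"
      using min[of "p - 1"] lt pk by (cases k) auto
    ultimately have "is_singleton s p"
      using is_singleton_iff[OF p] by blast
    then show "lrmin_w s p \<and> is_singleton s p"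
      unfolding lrmin_w_def pe using min p pk by auto
  qed
qed

lemma mark_weight_nth:
  "p < length s \<Longrightarrow> mark_weight (s ! p) w =
    (if s ! p \<le> s ! e \<and> marked (s ! p) w then if p < p1 then 1 else 2 else 0)"
  using nth_range[of p] unfolding mark_weight_def end1_eq
  by (simp only: after_nth mem_drop_1) auto

text \<open>Each of the d - c values in the interval from c + 1 to d weighs 2, except that those to
  the left of 1 weigh only 1.\<close>

lemma nu_eq: "nu s = (\<Sum>p<length s. mark_weight (s ! p) w)"
proof -
  define C where "C = {p. lrmin_w s p \<and> is_singleton s p}"
  have C: "C = {p. p < length s \<and> special (s ! p) w}"
    unfolding C_def by (rule lrmin_singleton_set_eq)
  have finC: "finite C" unfolding C by simp
  have marked: "marked v w \<longleftrightarrow> (\<exists>p\<in>C. s ! p < v)" for v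
  proof
    assume "marked v w"
    then obtain c where c: "1 \<le> c" "c < v" "special c w" by (auto simp: marked_def)
    then have "c \<in> set s"
      using special_iff[OF c(1)] lrmin_singleton_mem in_set_dropD by metis
    then obtain p where "p < length s" "s ! p = c" by (metis in_set_conv_nth)
    then show "\<exists>p\<in>C. s ! p < v" using c by (auto simp: C)
  next
    assume "\<exists>p\<in>C. s ! p < v"
    then obtain p where "p < length s" "special (s ! p) w" "s ! p < v" by (auto simp: C)
    then show "marked v w" using nth_range[of p] by (auto simp: marked_def)
  qed
  show ?thesis
  proof (cases "C = {}")
    case True
    then have "nu s = 0" unfolding nu_def C_def[symmetric] by simp
    moreover have "mark_weight (s ! p) w = 0" for p
      using marked True by (simp add: mark_weight_def)
    ultimately show ?thesis by simp
  next
    case False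
    define m where "m = Max C"
    define c where "c = s ! m"
    have m: "m \<in> C" unfolding m_def using finC False by (rule Max_in)
    \<comment> \<open>Left-to-right minima decrease, so the rightmost one is the least; being marked
      then means exceeding c.\<close>
    have c_min: "c \<le> s ! p" if "p \<in> C" for p
    proof (cases "p = m")
      case False
      then have "p < m" using that finC unfolding m_def by (metis Max_ge le_neq_implies_less)
      moreover have "pos s (dval s) < p" using that by (auto simp: C_def lrmin_w_def)
      ultimately show ?thesis using m unfolding c_def C_def lrmin_w_def by auto
    qed (simp add: c_def)
    have marked': "marked v w \<longleftrightarrow> c < v" for v
      unfolding marked using c_min m c_def by force
    have cd: "c < s ! e"
      using m nth_range[of m] special_iff[of c] by (auto simp: C c_def)
    let ?I = "{p. p < length s \<and> c < s ! p \<and> s ! p \<le> s ! e}"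
    let ?L = "{i. i < p1 \<and> c < s ! i \<and> s ! i < s ! e}"
    have "bij_betw ((!) s) ?I {c<..s ! e}"
    proof (rule bij_betw_subset[OF bij_nth])
      show "(!) s ` ?I = {c<..s ! e}"
      proof (intro equalityI subsetI)
        fix v assume v: "v \<in> {c<..s ! e}"
        then have "v \<in> set s" using set_s nth_range[OF e_lt] by auto
        then obtain p where "p < length s" "s ! p = v" by (metis in_set_conv_nth)
        then show "v \<in> (!) s ` ?I" using v by auto
      qed auto
    qed auto
    then have cI: "card ?I = s ! e - c"
      using bij_betw_same_card by fastforce
    \<comment> \<open>The strict bound in nleft agrees with the weak one in \<open>?I\<close>, as d
      is not to the left of 1.\<close>
    have LI: "?L = {p \<in> ?I. p < p1}"
    proof (intro set_eqI)
      fix i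
      have "s ! i \<noteq> s ! e" if "i < p1"
        using that p1_le_e e_lt dist by (simp add: nth_eq_iff_index_eq)
      then show "i \<in> ?L \<longleftrightarrow> i \<in> {p \<in> ?I. p < p1}"
        using p1 by auto
    qed
    have "(\<Sum>p<length s. mark_weight (s ! p) w) = (\<Sum>p<length s. if p \<in> ?I then if p < p1 then 1 else 2 else 0)"
      by (intro sum.cong) (auto simp: mark_weight_nth marked')
    also have "\<dots> = (\<Sum>p\<in>?I. if p < p1 then 1 else 2)"
      by (subst sum.inter_restrict[symmetric]) (auto intro!: sum.cong)
    \<comment> \<open>Adding nleft raises every weight to 2 and postpones the truncated subtraction
      until it is known to be exact.\<close>
    finally have "(\<Sum>p<length s. mark_weight (s ! p) w) + card ?L = (\<Sum>p\<in>?I. if p < p1 then 1 else 2) + (\<Sum>p\<in>?I. of_bool (p < p1))"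
      unfolding LI by (simp add: sum.If_cases of_bool_def Int_def)
    also have "\<dots> = (\<Sum>p\<in>?I. 2)"
      unfolding sum.distrib[symmetric] by (intro sum.cong) auto
    also have "\<dots> = 2 * (s ! e - c)"
      using cI by simp
    finally have "(\<Sum>p<length s. mark_weight (s ! p) w) = 2 * (s ! e - c) - card ?L"
      by simp
    moreover have "nu s = 2 * (s ! e - c) - card ?L"
      unfolding nu_def C_def[symmetric] Let_def dval_eq m_def[symmetric] c_def[symmetric]
        p1_def[symmetric] using False by simp
    ultimately show ?thesis by simp
  qed
qed

lemma nruns_sum: "nruns s = (\<Sum>p<length s. of_bool (s ! p < last (before (s ! p) w)))"
proof -
  have "s ! p < last (before (s ! p) w) \<longleftrightarrow> p = 0 \<or> s ! p < s ! (p - 1)" if "p < length s" for p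
  proof (cases p)
    case 0
    then show ?thesis using nth_range[OF that] before_nth[OF that] by simp
  next
    case (Suc k)
    then have "last (Suc n # take p s) = s ! k"
      using that by (simp add: take_Suc_conv_app_nth)
    then show ?thesis using Suc before_nth[OF that] by simp
  qed
  then have "(\<Sum>p<length s. of_bool (s ! p < last (before (s ! p) w))) =
      (\<Sum>p<length s. of_bool (p = 0 \<or> s ! p < s ! (p - 1)) :: nat)"
    by (intro sum.cong) auto
  also have "\<dots> = card {p. p < length s \<and> (p = 0 \<or> s ! p < s ! (p - 1))}"
    by (simp add: of_bool_def sum.If_cases Int_def)
  finally show ?thesis using nruns_eq by simp
qed

text \<open>No value is below 1, so no ascent jumps over it and no special value precedes it; only
  the start of its run counts.\<close>

lemma contrib_1: "contrib 1 w = 1"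
proof -
  have nth: "before 1 w = Suc n # take p1 s" "after 1 w = drop (Suc p1) s"
    using before_nth[OF p1(1)] after_nth[OF p1(1)] p1 by simp_all
  have "0 \<notin> set s" using set_s by simp
  then have 0: "0 \<notin> set (Suc n # take p1 s)" "0 \<notin> set (drop (Suc p1) s)"
    by (auto dest: in_set_takeD in_set_dropD)
  have cross: "cross 1 xs = 0" if "0 \<notin> set xs" for xs
  proof -
    have "{j. Suc j < length xs \<and> xs ! j < 1 \<and> 1 < xs ! Suc j} = {}"
      using that by (auto simp: in_set_conv_nth)
    then show ?thesis by (simp only: cross_eq_card card.empty)
  qed
  have "1 \<notin> set (before 1 w)" "1 \<notin> set (after 1 w)"
    using mem_take_1[of p1] mem_drop_1[OF p1(1)] nth by simp_all
  then have "side_count 1 w (before 1 w) = 0" "side_count 1 w (after 1 w) = 0"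
    unfolding side_count_def using cross 0 nth by simp_all
  moreover have "1 < last (before 1 w)"
  proof (cases "p1 = 0")
    case True
    then show ?thesis using nth n by simp
  next
    case False
    then have l: "last (before 1 w) \<in> set (take p1 s)" using nth p1 by auto
    then have "last (before 1 w) \<in> {1..n}" using set_s in_set_takeD by fast
    moreover have "1 \<notin> set (take p1 s)" using mem_take_1[of p1] by simp
    then have "last (before 1 w) \<noteq> 1" using l by metis
    ultimately show ?thesis by simp
  qed
  moreover have "mark_weight 1 w = 0" by (simp add: mark_weight_def marked_def)
  ultimately show ?thesis by (simp add: contrib_def)
qed

lemma statistic_eq_total: "nruns s - 1 + 2 * lsg_star s + rsg_star s + nu s = total n w"
proof -
  have "nruns s + 2 * lsg_star s + rsg_star s + nu s = (\<Sum>p<length s. contrib (s ! p) w)"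
    unfolding nruns_sum nu_eq lsg_star_def rsg_star_def contrib_def
    by (simp add: sum.distrib sum_distrib_left lsg_star_at_eq rsg_star_at_eq)
  also have "\<dots> = (\<Sum>v=1..n. contrib v w)"
    using sum.reindex_bij_betw[OF bij_nth, of "\<lambda>v. contrib v w"] .
  also have "\<dots> = contrib 1 w + (\<Sum>v=2..n. contrib v w)"
    using sum.atLeast_Suc_atMost[OF n] by (simp add: numeral_2_eq_2)
  finally have *: "nruns s + 2 * lsg_star s + rsg_star s + nu s = 1 + total n w"
    unfolding contrib_1 total_def .
  \<comment> \<open>Position 0 starts a run, so \<open>nruns s - 1\<close> is not truncated.\<close>
  have "0 \<in> {p. p < length s \<and> (p = 0 \<or> s ! p < s ! (p - 1))}"
    using p1 by auto
  then have "nruns s \<noteq> 0" unfolding nruns_eq by (auto simp: card_eq_0_iff)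
  then show ?thesis using * by simp
qed

end

theorem theorem4:
  fixes q :: "'a::comm_ring_1" and n :: nat
  assumes "n \<ge> 1"
  shows "(\<Sum>s\<in>permutations_of_set {1..n}.
            q ^ (nruns s - 1 + 2 * lsg_star s + rsg_star s + nu s)) = qfact n q"
proof -
  have "nruns s - 1 + 2 * lsg_star s + rsg_star s + nu s = total n (Suc n # s)"
    if "s \<in> permutations_of_set {1..n}" for s
  proof -
    interpret std_perm s n
      using that assms by unfold_locales (auto simp: permutations_of_set_def)
    show ?thesis by (rule statistic_eq_total)
  qed
  then show ?thesis
    using sum_permutations_total[OF assms, of q] by simp
qed

end
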